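(* Let $k$ be a positive integer, and for each integer $\ell\ge 1$ let $(R_{k\times k,\ell},\partial,Y^+(\cdot,z))$ be the conformal algebra defined in the context, i.e. $R_{k\times k,1}=\mathrm{span}\{u_{[1,1]}(m,n)\mid u\in M_{k\times k}(\mathbb{F}),\ m,n\in\mathbb{N}\}$ and, for $\ell\ge 2$, $R_{k\times k,\ell}=\mathrm{span}\{u_{[0,0]}(m,n)\mid u\in M_{k\times k}(\mathbb{F}),\ m,n\in\mathbb{N},\ n\ge \ell-2\}$. Then: (1) For every integer $\ell\ge 1$, the conformal algebra $R_{k\times k,\ell}$ is simple. (2) For every integer $\ell\ge 2$, the algebra $R_{k\times k,\ell}$ is generated by its subspace $R_{k\times k,\ell}^{(\ell)}=\{u_{[0,0]}(0,\ell-2)\mid u\in M_{k\times k}(\mathbb{F})\}$ of weight $\ell$ if $k>1$, and by the set $\{(I_1)_{[0,0]}(0,\ell-2),\ (I_1)_{[0,0]}(0,\ell-1)\}$ if $k=1$. (3) The algebra $R_{k\times k,1}$ is generated by its subspace of weight $2$, $R_{k\times k,1}^{(2)}=\mathrm{span}\{u_{[1,1]}(1,0),u_{[1,1]}(0,1)\mid u\in M_{k\times k}(\mathbb{F})\}$, if $k>1$, and by the set $\{(I_1)_{[1,1]}(1,0),\ (I_1)_{[1,1]}(0,2)\}$ if $k=1$.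
   Context: Conventions. $\mathbb{F}$ is an arbitrary field of characteristic $0$; $\mathbb{N}=\{0,1,2,\dots\}$; $\binom{a}{n}=a(a-1)\cdots(a-n+1)/n!$ for $a\in\mathbb{Z}$, $n\in\mathbb{N}$. $I_1$ is the $1\times 1$ identity matrix. $\mathrm{Res}_x$ takes the coefficient of $x^{-1}$. All binomials such as $(z-x)^{-1}$ are expanded in nonnegative powers of the second variable. $LM(V_1,V_2)$ is the space of linear maps $V_1\to V_2$. Conformal superalgebra. A conformal superalgebra $(R,\partial,Y^+(\cdot,z))$ is a $\mathbb{Z}_2$-graded $\mathbb{F}[\partial]$-module $R=R_0\oplus R_1$ with a $\mathbb{Z}_2$-graded linear map $Y^+(\cdot,z):R\to LM(R,R[z^{-1}]z^{-1})$ such that, for $u\in R_i$, $v\in R_j$: $Y^+(\partial u,z)=\frac{d}{dz}Y^+(u,z)$; $Y^+(u,z)v=(-1)^{ij}\mathrm{Res}_x\frac{e^{x\partial}Y^+(v,-x)u}{z-x}$; $Y^+(u,z_1)Y^+(v,z_2)-(-1)^{ij}Y^+(v,z_2)Y^+(u,z_1)=\mathrm{Res}_x\frac{Y^+(Y^+(u,z_1-x)v,x)}{z_2-x}$. If $R_1=\{0\}$ it is called a conformal algebra. Write $Y^+(u,z)=\sum_{n\ge 0}u_nz^{-n-1}$. An ideal is a subspace $\mathcal{I}\subset R$ with $\partial(\mathcal{I})\subset\mathcal{I}$ and $Y^+(u,z)\mathcal{I}\subset\mathcal{I}[z^{-1}]$ for all $u\in R$. $R$ is simple if its only ideals are $\{0\}$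 and $R$. A (sub-)algebra $R'$ is generated by a subset $S$ if $R'=\mathrm{span}\{u^1_{m_1}\cdots u^p_{m_p}v\mid u^1,\dots,u^p,v\in S,\ p,m_1,\dots,m_p\in\mathbb{N}\}$ (for $p=0$ the expression is $v$). Construction. Let $\mathcal{A}=M_{k\times k}(\mathbb{F})$ be the algebra of $k\times k$ matrices. For each $i\in\{0,1\}$ take the vector space $\mathcal{A}\otimes\mathbb{F}[t_1,t_2]$ and denote $u\otimes t_1^mt_2^n$ in the $i$-th copy by $u_{[i,i]}(m,n)$ ($u\in\mathcal{A}$, $m,n\in\mathbb{N}$). On each copy define $$\partial u_{[i,i]}(m,n)=(m+1)u_{[i,i]}(m+1,n)+(n+1)u_{[i,i]}(m,n+1)$$ and $$Y^+(u_{[i,i]}(m_1,m_2),z)v_{[i,i]}(n_1,n_2)=(n_1\delta_{i,0}+1)\binom{-n_1-1-\delta_{i,0}}{m_2}\sum_{p=0}^{m_1+m_2+n_1+\delta_{i,0}}\binom{p}{m_1}(uv)_{[i,i]}(p,n_2)z^{p-m_1-m_2-n_1-1-\delta_{i,0}}$$ $$-\bigl(\delta_{i,1}-(n_2+1)\delta_{i,0}\bigr)\binom{-n_2-1-\delta_{i,0}}{m_1}\sum_{q=0}^{m_1+m_2+n_2+\delta_{i,0}}\binom{q}{m_2}(vu)_{[i,i]}(n_1,q)z^{q-m_1-m_2-n_2-1-\delta_{i,0}}.$$ Each copy is a conformal algebra (odd part zero), and the subspaces $R_{k\times k,\ell}$ of the claim are closed under $\partial$ and $Y^+$, hence are conformal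 algebras. The weight of $u_{[0,0]}(m,n)$ is $m+n+2$ and the weight of $u_{[1,1]}(m,n)$ is $m+n+1$; $R_{k\times k,1}^{(w)}$ is the span of the elements $u_{[1,1]}(m,n)$ with $u\in\mathcal{A}$, $m,n\in\mathbb{N}$ and $m+n+1=w$, and, for $\ell\ge 2$, $R_{k\times k,\ell}^{(w)}$ is the span of the elements $u_{[0,0]}(m,n)$ with $u\in\mathcal{A}$, $m,n\in\mathbb{N}$, $n\ge\ell-2$ and $m+n+2=w$. *)

theory Defs
  imports "HOL-Analysis.Analysis" "HOL-Library.Poly_Mapping" "HOL-Library.Z2"
begin

section \<open>Conformal superalgebras\<close>

text \<open>
  \<open>R i\<close> is the homogeneous part of degree \<open>i\<close>; both parts live in an ambient vector space of
  type \<open>'v\<close>, and \<open>D\<close> (for \<open>\<partial>\<close>) and \<open>Y\<close> matter only on their sum.  The Laurent polynomial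
  \<open>Y\<^sup>+(u,z)v\<close> is the finitely supported function \<open>Y u v\<close> mapping an exponent \<open>e\<close> to the
  coefficient of \<open>z\<^sup>e\<close>; so \<open>u\<^sub>n v\<close> is its value at \<open>-n-1\<close>.
\<close>

locale conformal_data = vector_space scale
  for scale :: "'a::field_char_0 \<Rightarrow> 'v::ab_group_add \<Rightarrow> 'v" +
  fixes R :: "bit \<Rightarrow> 'v set"
    and D :: "'v \<Rightarrow> 'v"
    and Y :: "'v \<Rightarrow> 'v \<Rightarrow> (int \<Rightarrow>\<^sub>0 'v)"
begin

definition total :: "'v set" where
  "total = {u + v | u v. u \<in> R 0 \<and> v \<in> R 1}"

definition nprod :: "'v \<Rightarrow> nat \<Rightarrow> 'v \<Rightarrow> 'v" where
  "nprod u n v = Poly_Mapping.lookup (Y u v) (- int n - 1)"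

definition ideal :: "'v set \<Rightarrow> bool" where
  "ideal I \<longleftrightarrow> subspace I \<and> I \<subseteq> total \<and> D ` I \<subseteq> I \<and>
     (\<forall>u\<in>total. \<forall>v\<in>I. \<forall>e. Poly_Mapping.lookup (Y u v) e \<in> I)"

definition simple :: bool where
  "simple \<longleftrightarrow> (\<forall>I. ideal I \<longrightarrow> I = {0} \<or> I = total)"

definition generated_by :: "'v set \<Rightarrow> bool" where
  "generated_by S \<longleftrightarrow>
     total = span {foldr (\<lambda>(u, m) w. nprod u m w) us v | us v. fst ` set us \<subseteq> S \<and> v \<in> S}"

end

text \<open>
  The last two axioms are the coefficients of \<open>z\<^sup>-\<^sup>n\<^sup>-\<^sup>1\<close>, resp. of \<open>z\<^sub>1\<^sup>-\<^sup>m\<^sup>-\<^sup>1z\<^sub>2\<^sup>-\<^sup>n\<^sup>-\<^sup>1\<close>, in the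
  identities
  \<open>Y\<^sup>+(u,z)v = (-1)\<^sup>i\<^sup>jRes\<^sub>x e\<^sup>x\<^sup>\<partial>Y\<^sup>+(v,-x)u / (z-x)\<close> and
  \<open>Y\<^sup>+(u,z\<^sub>1)Y\<^sup>+(v,z\<^sub>2) - (-1)\<^sup>i\<^sup>jY\<^sup>+(v,z\<^sub>2)Y\<^sup>+(u,z\<^sub>1) = Res\<^sub>x Y\<^sup>+(Y\<^sup>+(u,z\<^sub>1-x)v,x) / (z\<^sub>2-x)\<close>,
  all binomials being expanded in nonnegative powers of \<open>x\<close>; by \<open>Y_negative\<close> no other
  coefficients occur.
\<close>

locale conformal_superalgebra = conformal_data scale R D Y
  for scale :: "'a::field_char_0 \<Rightarrow> 'v::ab_group_add \<Rightarrow> 'v" and R D Y +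
  assumes subspace_R: "subspace (R i)"
    and direct: "R 0 \<inter> R 1 = {0}"
    and D_graded: "u \<in> R i \<Longrightarrow> D u \<in> R i"
    and D_add: "u \<in> total \<Longrightarrow> v \<in> total \<Longrightarrow> D (u + v) = D u + D v"
    and D_scale: "u \<in> total \<Longrightarrow> D (scale c u) = scale c (D u)"
    and Y_graded: "u \<in> R i \<Longrightarrow> v \<in> R j \<Longrightarrow> Poly_Mapping.lookup (Y u v) e \<in> R (i + j)"
    and Y_negative: "u \<in> total \<Longrightarrow> v \<in> total \<Longrightarrow> e \<ge> 0 \<Longrightarrow> Poly_Mapping.lookup (Y u v) e = 0"
    and Y_add_left: "u \<in> total \<Longrightarrow> v \<in> total \<Longrightarrow> w \<in> total \<Longrightarrow> Y (u + v) w = Y u w + Y v w"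
    and Y_add_right: "u \<in> total \<Longrightarrow> v \<in> total \<Longrightarrow> w \<in> total \<Longrightarrow> Y u (v + w) = Y u v + Y u w"
    and Y_scale_left:
      "u \<in> total \<Longrightarrow> v \<in> total \<Longrightarrow> Y (scale c u) v = Poly_Mapping.map (scale c) (Y u v)"
    and Y_scale_right:
      "u \<in> total \<Longrightarrow> v \<in> total \<Longrightarrow> Y u (scale c v) = Poly_Mapping.map (scale c) (Y u v)"
    and Y_derivative: "u \<in> total \<Longrightarrow> v \<in> total \<Longrightarrow>
      Poly_Mapping.lookup (Y (D u) v) e = scale (of_int (e + 1)) (Poly_Mapping.lookup (Y u v) (e + 1))"
    and skew_symmetry: "u \<in> R i \<Longrightarrow> v \<in> R j \<Longrightarrow>
      nprod u n v = scale (if i = 1 \<and> j = 1 then -1 else 1)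
        (Sum_any (\<lambda>k. scale ((-1) ^ (n + k + 1) / fact k) ((D ^^ k) (nprod v (n + k) u))))"
    and commutator: "u \<in> R i \<Longrightarrow> v \<in> R j \<Longrightarrow> w \<in> total \<Longrightarrow>
      nprod u m (nprod v n w) - scale (if i = 1 \<and> j = 1 then -1 else 1) (nprod v n (nprod u m w))
        = (\<Sum>p\<le>m. scale (of_nat (m choose p)) (nprod (nprod u (m - p) v) (n + p) w))"

locale conformal_algebra = conformal_superalgebra +
  assumes odd_part: "R 1 = {0}"

section \<open>The algebras \<open>R\<^sub>k\<^sub>\<times>\<^sub>k\<^sub>,\<^sub>\<ell>\<close>\<close>

text \<open>
  The base field is \<open>'a\<close>.  An element of either copy of \<open>M\<^sub>k\<^sub>\<times>\<^sub>k('a) \<otimes> 'a[t\<^sub>1,t\<^sub>2]\<close> is a polynomial in \<open>t\<^sub>1,t\<^sub>2\<close> with matrix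
  coefficients, \<open>k = CARD('n)\<close>; \<open>elt u m n\<close> is \<open>u \<otimes> t\<^sub>1\<^sup>mt\<^sub>2\<^sup>n\<close>.  The two copies have the same
  underlying space and the same \<open>\<partial>\<close> and differ only in \<open>Y\<^sup>+\<close>, so the copy is an argument \<open>i\<close>
  (\<open>0\<close> or \<open>1\<close>) of \<open>kk_Y\<close> only.
\<close>

type_synonym ('a, 'n) kk = "(nat \<times> nat) \<Rightarrow>\<^sub>0 ('a^'n^'n)"

definition mat_scale :: "'a::field_char_0 \<Rightarrow> 'a^'n^'n \<Rightarrow> 'a^'n^'n" where
  "mat_scale c = map_matrix (\<lambda>x. c * x)"

definition kk_scale :: "'a::field_char_0 \<Rightarrow> ('a, 'n::finite) kk \<Rightarrow> ('a, 'n) kk" where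
  "kk_scale c = Poly_Mapping.map (mat_scale c)"

definition elt :: "'a::field_char_0^'n^'n \<Rightarrow> nat \<Rightarrow> nat \<Rightarrow> ('a, 'n::finite) kk" where
  "elt u m n = Poly_Mapping.single (m, n) u"

definition kk_deriv :: "('a::field_char_0, 'n::finite) kk \<Rightarrow> ('a, 'n) kk" where
  "kk_deriv P = (\<Sum>(m, n)\<in>Poly_Mapping.keys P. let u = Poly_Mapping.lookup P (m, n) in
     kk_scale (of_nat m + 1) (elt u (m + 1) n) + kk_scale (of_nat n + 1) (elt u m (n + 1)))"

definition kk_Y_elt ::
  "nat \<Rightarrow> 'a::field_char_0^'n^'n \<Rightarrow> nat \<Rightarrow> nat \<Rightarrow> 'a^'n^'n \<Rightarrow> nat \<Rightarrow> nat \<Rightarrow> (int \<Rightarrow>\<^sub>0 ('a, 'n::finite) kk)"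
  where
  "kk_Y_elt i u m1 m2 v n1 n2 =
     (\<Sum>p\<le>m1 + m2 + n1 + of_bool (i = 0).
        Poly_Mapping.single (int p - int m1 - int m2 - int n1 - 1 - of_bool (i = 0))
          (kk_scale ((of_nat n1 * of_bool (i = 0) + 1)
              * ((- of_nat n1 - 1 - of_bool (i = 0)) gchoose m2) * of_nat (p choose m1))
            (elt (u ** v) p n2)))
   - (\<Sum>q\<le>m1 + m2 + n2 + of_bool (i = 0).
        Poly_Mapping.single (int q - int m1 - int m2 - int n2 - 1 - of_bool (i = 0))
          (kk_scale ((of_bool (i = 1) - (of_nat n2 + 1) * of_bool (i = 0))
              * ((- of_nat n2 - 1 - of_bool (i = 0)) gchoose m1) * of_nat (q choose m2))
            (elt (v ** u) n1 q)))"

definition kk_Y ::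
  "nat \<Rightarrow> ('a::field_char_0, 'n::finite) kk \<Rightarrow> ('a, 'n) kk \<Rightarrow> (int \<Rightarrow>\<^sub>0 ('a, 'n) kk)" where
  "kk_Y i P Q = (\<Sum>(m1, m2)\<in>Poly_Mapping.keys P. \<Sum>(n1, n2)\<in>Poly_Mapping.keys Q.
     kk_Y_elt i (Poly_Mapping.lookup P (m1, m2)) m1 m2 (Poly_Mapping.lookup Q (n1, n2)) n1 n2)"

text \<open>
  Only \<open>\<ell> \<ge> 1\<close> is meant in the following; \<open>\<ell> = 1\<close> uses copy 1 and \<open>\<ell> \<ge> 2\<close> copy 0.
\<close>

definition kk_copy :: "nat \<Rightarrow> nat" where
  "kk_copy l = (if l = 1 then 1 else 0)"

definition kk_R :: "nat \<Rightarrow> ('a::field_char_0, 'n::finite) kk set" where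
  "kk_R l = (if l = 1 then module.span kk_scale {elt u m n | u m n. True}
             else module.span kk_scale {elt u m n | u m n. n \<ge> l - 2})"

definition kk_weight_space :: "nat \<Rightarrow> nat \<Rightarrow> ('a::field_char_0, 'n::finite) kk set" where
  "kk_weight_space l w =
     (if l = 1 then module.span kk_scale {elt u m n | u m n. m + n + 1 = w}
      else module.span kk_scale {elt u m n | u m n. n \<ge> l - 2 \<and> m + n + 2 = w})"

definition kk_grading :: "nat \<Rightarrow> bit \<Rightarrow> ('a::field_char_0, 'n::finite) kk set" where
  "kk_grading l i = (if i = 0 then kk_R l else {0})"

section \<open>The \<open>R\<^sub>k\<^sub>\<times>\<^sub>k\<^sub>,\<^sub>\<ell>\<close> are conformal algebras\<close>

text \<open>
  Evaluating \<open>elt u m n\<close> at \<open>(a,b)\<close> as \<open>a\<^sup>mb\<^sup>n/(m!n!) u\<close> turns \<open>\<partial>\<close> into multiplication by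
  \<open>a+b\<close> and the generating function of \<open>u\<^sub>n v\<close> into \<open>kk_bracket\<close>, for which the axioms are
  matrix identities.
\<close>

lemma mat_scale_nth [simp]: "mat_scale c A $ r $ s = c * A $ r $ s"
  by (simp add: mat_scale_def)

lemma mat_eqI: "(\<And>r s. A $ r $ s = B $ r $ s) \<Longrightarrow> A = (B :: 'a^'n^'n)"
  by (simp add: vec_eq_iff)

lemma mat_scale_simps [simp]:
  "mat_scale c 0 = 0" "mat_scale 0 A = 0" "mat_scale 1 A = A"
  "mat_scale c (mat_scale d A) = mat_scale (c * d) A"
  by (rule mat_eqI, simp add: mult.assoc)+

lemma mat_scale_algebra:
  "mat_scale c (A + B) = mat_scale c A + mat_scale c B"
  "mat_scale c (A - B) = mat_scale c A - mat_scale c B"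
  "mat_scale (c + d) A = mat_scale c A + mat_scale d A"
  "mat_scale (c - d) A = mat_scale c A - mat_scale d A"
  "mat_scale (- c) A = - mat_scale c A"
  "mat_scale c (- A) = - mat_scale c A"
  by (auto intro!: mat_eqI simp: algebra_simps)

lemma mat_scale_mult:
  "mat_scale c A ** B = mat_scale c (A ** B)" "A ** mat_scale c B = mat_scale c (A ** B)"
  by (auto intro!: mat_eqI simp: matrix_matrix_mult_def sum_distrib_left mult_ac)

lemma mat_scale_sum: "mat_scale c (sum f A) = (\<Sum>x\<in>A. mat_scale c (f x))"
  by (induction A rule: infinite_finite_induct) (auto simp: mat_scale_algebra)

lemma mat_scale_sum_left: "mat_scale (sum f A) B = (\<Sum>x\<in>A. mat_scale (f x) B)"
  by (induction A rule: infinite_finite_induct) (auto simp: mat_scale_algebra)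

lemma matrix_mult_algebra:
  fixes A :: "'a::field_char_0^'n^'n"
  shows "A ** (B + C) = A ** B + A ** C" "(A + B) ** C = A ** C + B ** C"
    "A ** (B - C) = A ** B - A ** C" "(A - B) ** C = A ** C - B ** C"
    "(0 :: 'a^'n^'n) ** A = 0" "A ** (0 :: 'a^'n^'n) = 0" "- A ** B = - (A ** B)" "A ** - B = - (A ** B)"
  by (rule mat_eqI, simp add: matrix_matrix_mult_def sum.distrib algebra_simps sum_subtractf sum_negf)+

lemma matrix_mult_sum:
  fixes A :: "'a::field_char_0^'n^'n"
  shows "A ** sum f S = (\<Sum>x\<in>S. A ** f x)" "sum f S ** A = (\<Sum>x\<in>S. f x ** A)"
  by (induction S rule: infinite_finite_induct) (auto simp: matrix_mult_algebra)

lemma lookup_map_0: "f 0 = 0 \<Longrightarrow> Poly_Mapping.lookup (Poly_Mapping.map f P) x = f (Poly_Mapping.lookup P x)"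
  by (simp add: Poly_Mapping.map.rep_eq when_def)

lemma lookup_kk_scale [simp]:
  "Poly_Mapping.lookup (kk_scale c P) x = mat_scale c (Poly_Mapping.lookup P x)"
  by (simp add: kk_scale_def lookup_map_0)

lemma kk_eqI: "(\<And>x. Poly_Mapping.lookup P x = Poly_Mapping.lookup Q x) \<Longrightarrow> P = Q"
  by (rule poly_mapping_eqI)

interpretation kk: vector_space "kk_scale :: 'a::field_char_0 \<Rightarrow> ('a, 'n::finite) kk \<Rightarrow> _"
  by unfold_locales (auto intro!: kk_eqI simp: lookup_add mat_scale_algebra)

lemma kk_scale_elt: "kk_scale c (elt u m n) = elt (mat_scale c u) m n"
  by (auto intro!: kk_eqI simp: elt_def lookup_single when_def)

lemma elt_add: "elt (u + v) m n = elt u m n + elt v m n"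
  by (simp add: elt_def single_add)

lemma elt_0 [simp]: "elt 0 m n = 0"
  by (simp add: elt_def)

text \<open>Extension of a function that is additive in the coefficients.\<close>

definition lext :: "('k \<Rightarrow> 'b::ab_group_add \<Rightarrow> 'c::ab_group_add) \<Rightarrow> ('k \<Rightarrow>\<^sub>0 'b) \<Rightarrow> 'c" where
  "lext f P = (\<Sum>x\<in>Poly_Mapping.keys P. f x (Poly_Mapping.lookup P x))"

lemma lext_superset:
  assumes "\<And>x. f x 0 = 0" "finite A" "Poly_Mapping.keys P \<subseteq> A"
  shows "lext f P = (\<Sum>x\<in>A. f x (Poly_Mapping.lookup P x))"
  unfolding lext_def using assms by (intro sum.mono_neutral_left) (auto simp: in_keys_iff)

lemma lext_add:
  assumes f: "\<And>x c d. f x (c + d) = f x c + f x d"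
  shows "lext f (P + Q) = lext f P + lext f Q"
proof -
  have f0: "f x 0 = 0" for x using f[of x 0 0] by simp
  let ?A = "Poly_Mapping.keys P \<union> Poly_Mapping.keys Q"
  have "lext f R = (\<Sum>x\<in>?A. f x (Poly_Mapping.lookup R x))" if "R \<in> {P, Q, P + Q}" for R
    using that keys_add[of P Q] by (intro lext_superset) (auto simp: f0)
  then show ?thesis by (simp add: lookup_add f sum.distrib)
qed

lemma lext_single: "f x 0 = 0 \<Longrightarrow> lext f (Poly_Mapping.single x c) = f x c"
  by (simp add: lext_def)

lemma additive_0: "(\<And>x y. f (x + y) = f x + f y) \<Longrightarrow> f 0 = 0"
  for f :: "'a::ab_group_add \<Rightarrow> 'b::ab_group_add"
  by (metis add_cancel_right_right)

lemma additive_minus: "(\<And>x y. f (x + y) = f x + f y) \<Longrightarrow> f (x - y) = f x - f y"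
  for f :: "'a::ab_group_add \<Rightarrow> 'b::ab_group_add"
  by (metis add_diff_cancel diff_add_cancel)

lemma additive_sum: "(\<And>x y. f (x + y) = f x + f y) \<Longrightarrow> f (sum g A) = (\<Sum>x\<in>A. f (g x))"
  for f :: "'a::ab_group_add \<Rightarrow> 'b::ab_group_add"
  by (induction A rule: infinite_finite_induct) (auto simp: additive_0)

lemma pm_induct:
  assumes "\<And>x c. Q (Poly_Mapping.single x c)" "\<And>P P'. Q P \<Longrightarrow> Q P' \<Longrightarrow> Q (P + P')"
  shows "Q (P :: 'k \<Rightarrow>\<^sub>0 'b::ab_group_add)"
proof -
  have "P = (\<Sum>x\<in>Poly_Mapping.keys P. Poly_Mapping.single x (Poly_Mapping.lookup P x))"
    by (intro poly_mapping_eqI) (auto simp: lookup_sum lookup_single when_def in_keys_iff)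
  moreover have "Q (\<Sum>x\<in>A. Poly_Mapping.single x (f x))" for A and f :: "'k \<Rightarrow> 'b"
    by (induction A rule: infinite_finite_induct) (auto intro: assms simp: assms(1)[of undefined 0, simplified])
  ultimately show ?thesis by metis
qed

lemma kk_induct [case_names elt add]:
  assumes "\<And>u m n. Q (elt u m n)" "\<And>x y. Q x \<Longrightarrow> Q y \<Longrightarrow> Q (x + y)"
  shows "Q x"
  using assms by (induction x rule: pm_induct) (auto simp: elt_def)

lemma kk_deriv_lext:
  "kk_deriv P = lext (\<lambda>(m, n) u. kk_scale (of_nat m + 1) (elt u (m + 1) n)
     + kk_scale (of_nat n + 1) (elt u m (n + 1))) P"
  by (simp add: kk_deriv_def lext_def split_def Let_def)

lemma kk_deriv_add: "kk_deriv (P + Q) = kk_deriv P + kk_deriv Q"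
  unfolding kk_deriv_lext
  by (rule lext_add) (auto simp: elt_add kk.scale_right_distrib)

lemma kk_deriv_elt: "kk_deriv (elt u m n) =
  kk_scale (of_nat m + 1) (elt u (m + 1) n) + kk_scale (of_nat n + 1) (elt u m (n + 1))"
  unfolding kk_deriv_lext by (subst (1) elt_def) (simp add: lext_single)

lemma kk_deriv_scale: "kk_deriv (kk_scale c P) = kk_scale c (kk_deriv P)"
  by (induction P rule: kk_induct)
     (simp_all add: kk_deriv_add kk_deriv_elt kk.scale_right_distrib kk_scale_elt mult_ac)

lemma kk_Y_lext:
  "kk_Y i P Q = lext (\<lambda>(m1, m2) u. lext (\<lambda>(n1, n2) v. kk_Y_elt i u m1 m2 v n1 n2) Q) P"
  by (simp add: kk_Y_def lext_def split_def)

lemma kk_Y_elt_add: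
  "kk_Y_elt i (u + u') m1 m2 v n1 n2 = kk_Y_elt i u m1 m2 v n1 n2 + kk_Y_elt i u' m1 m2 v n1 n2"
  "kk_Y_elt i u m1 m2 (v + v') n1 n2 = kk_Y_elt i u m1 m2 v n1 n2 + kk_Y_elt i u m1 m2 v' n1 n2"
  by (simp_all add: kk_Y_elt_def matrix_mult_algebra elt_add kk.scale_right_distrib single_add
      sum.distrib)

lemma kk_Y_elt_0 [simp]: "kk_Y_elt i 0 m1 m2 v n1 n2 = 0" "kk_Y_elt i u m1 m2 0 n1 n2 = 0"
  by (simp_all add: kk_Y_elt_def matrix_mult_algebra)

lemma kk_Y_add_right: "kk_Y i P (Q + Q') = kk_Y i P Q + kk_Y i P Q'"
proof -
  have "lext (\<lambda>(n1, n2) v. kk_Y_elt i u m1 m2 v n1 n2) (Q + Q')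
     = lext (\<lambda>(n1, n2) v. kk_Y_elt i u m1 m2 v n1 n2) Q
     + lext (\<lambda>(n1, n2) v. kk_Y_elt i u m1 m2 v n1 n2) Q'" for u m1 m2
    by (rule lext_add) (auto simp: kk_Y_elt_add)
  then show ?thesis
    unfolding kk_Y_lext by (simp add: lext_def split_def sum.distrib)
qed

lemma kk_Y_add_left: "kk_Y i (P + P') Q = kk_Y i P Q + kk_Y i P' Q"
  unfolding kk_Y_lext
  by (rule lext_add) (auto simp: kk_Y_elt_add lext_def sum.distrib split_def)

lemma kk_Y_elt_elt: "kk_Y i (elt u m1 m2) (elt v n1 n2) = kk_Y_elt i u m1 m2 v n1 n2"
  by (simp add: kk_Y_lext elt_def lext_single lext_def)

lemma map_kk_scale_single:
  "Poly_Mapping.map (kk_scale c) (Poly_Mapping.single e P) = Poly_Mapping.single e (kk_scale c P)"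
  by (rule map_single) (simp add: kk.scale_zero_right)

lemma map_kk_scale_add:
  "Poly_Mapping.map (kk_scale c) (S + T) = Poly_Mapping.map (kk_scale c) S + Poly_Mapping.map (kk_scale c) T"
  by (auto intro!: poly_mapping_eqI simp: lookup_map_0 lookup_add kk.scale_right_distrib)

lemma kk_Y_elt_scale:
  "kk_Y_elt i (mat_scale c u) m1 m2 v n1 n2 = Poly_Mapping.map (kk_scale c) (kk_Y_elt i u m1 m2 v n1 n2)"
  "kk_Y_elt i u m1 m2 (mat_scale c v) n1 n2 = Poly_Mapping.map (kk_scale c) (kk_Y_elt i u m1 m2 v n1 n2)"
  by (simp_all only: kk_Y_elt_def additive_minus[of "Poly_Mapping.map (kk_scale c)", OF map_kk_scale_add]
      additive_sum[of "Poly_Mapping.map (kk_scale c)", OF map_kk_scale_add]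
      map_kk_scale_single mat_scale_mult kk_scale_elt mat_scale_simps mult_ac)

lemma kk_Y_scale_left: "kk_Y i (kk_scale c P) Q = Poly_Mapping.map (kk_scale c) (kk_Y i P Q)"
proof (induction P rule: kk_induct)
  case (elt u m n)
  show ?case
    by (induction Q rule: kk_induct)
      (simp_all add: kk_scale_elt kk_Y_add_right map_kk_scale_add kk_Y_elt_elt kk_Y_elt_scale)
qed (simp add: kk_Y_add_left map_kk_scale_add kk.scale_right_distrib)

lemma kk_Y_scale_right: "kk_Y i P (kk_scale c Q) = Poly_Mapping.map (kk_scale c) (kk_Y i P Q)"
proof (induction P rule: kk_induct)
  case (elt u m n)
  show ?case
    by (induction Q rule: kk_induct)
      (simp_all add: kk_scale_elt kk_Y_add_right map_kk_scale_add kk_Y_elt_elt kk_Y_elt_scale kk.scale_right_distrib)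
qed (simp add: kk_Y_add_left map_kk_scale_add)

definition kk_eval :: "('a::field_char_0, 'n::finite) kk \<Rightarrow> 'a \<Rightarrow> 'a \<Rightarrow> 'a^'n^'n" where
  "kk_eval P a b = lext (\<lambda>(m, n) u. mat_scale (a ^ m / fact m * (b ^ n / fact n)) u) P"

lemma kk_eval_add: "kk_eval (P + Q) a b = kk_eval P a b + kk_eval Q a b"
  unfolding kk_eval_def by (rule lext_add) (auto simp: mat_scale_algebra)

lemma kk_eval_elt: "kk_eval (elt u m n) a b = mat_scale (a ^ m / fact m * (b ^ n / fact n)) u"
  unfolding kk_eval_def elt_def by (subst lext_single) auto

lemma kk_eval_0 [simp]: "kk_eval 0 a b = 0"
  by (simp add: kk_eval_def lext_def)

lemma kk_eval_scale: "kk_eval (kk_scale c P) a b = mat_scale c (kk_eval P a b)"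
  by (induction P rule: kk_induct)
    (simp_all add: kk_eval_add kk_eval_elt kk_scale_elt kk.scale_right_distrib mat_scale_algebra mult_ac)

lemma fact_Suc_div: "(of_nat m + 1) * (x * a ^ m / fact (Suc m)) = x * a ^ m / (fact m :: 'a::field_char_0)"
proof -
  have "(of_nat m + 1 :: 'a) \<noteq> 0" by (metis of_nat_Suc of_nat_neq_0 add.commute)
  then show ?thesis by (simp add: fact_Suc add.commute)
qed

lemma kk_eval_deriv: "kk_eval (kk_deriv P) a b = mat_scale (a + b) (kk_eval P a b)"
proof (induction P rule: kk_induct)
  case (elt u m n)
  have "(of_nat m + 1) * (a ^ (m + 1) / fact (m + 1) * (b ^ n / fact n))
      + (of_nat n + 1) * (a ^ m / fact m * (b ^ (n + 1) / fact (n + 1)))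
      = (a + b) * (a ^ m / fact m * (b ^ n / fact n))"
  proof -
    have *: "c1 * (A1 * B0) + c2 * (A0 * B1) = (a + b) * (A0 * B0)"
      if "c1 * A1 = a * A0" "c2 * B1 = b * B0" for c1 c2 A1 A0 B1 B0
      using that by algebra
    show ?thesis
      using fact_Suc_div[of m a a] fact_Suc_div[of n b b] by (intro *) simp_all
  qed
  then show ?case
    by (simp add: kk_deriv_elt kk_eval_add kk_eval_scale kk_eval_elt flip: mat_scale_algebra(3))
qed (simp add: kk_deriv_add kk_eval_add mat_scale_algebra)

lemma kk_eval_deriv_pow: "kk_eval ((kk_deriv ^^ k) P) a b = mat_scale ((a + b) ^ k) (kk_eval P a b)"
  by (induction k) (simp_all add: kk_eval_deriv)

lemma scalar_series_inj:
  assumes "\<And>x :: 'a::field_char_0. (\<Sum>n<N. x ^ n / fact n * f n) = 0" and "n < N"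
  shows "f n = 0"
proof -
  let ?p = "\<Sum>n<N. monom (f n / fact n) n"
  have "poly ?p x = 0" for x
    using assms(1)[of x] by (simp add: poly_sum poly_monom field_simps)
  then have "?p = 0" using poly_all_0_iff_0[of ?p] by blast
  then have "coeff ?p n = 0" by simp
  then show ?thesis using assms(2) by (simp add: coeff_sum if_distrib cong: if_cong)
qed

lemma series_inj:
  fixes f :: "nat \<Rightarrow> 'a::field_char_0^'n^'n"
  assumes "\<And>x. (\<Sum>n<N. mat_scale (x ^ n / fact n) (f n)) = 0" and "n < N"
  shows "f n = 0"
proof (rule mat_eqI)
  fix r s
  have "(\<Sum>n<N. x ^ n / fact n * f n $ r $ s) = 0" for x
    using arg_cong[OF assms(1)[of x], of "\<lambda>A. A $ r $ s"] by simp
  from scalar_series_inj[where N = N and f = "\<lambda>n. f n $ r $ s", OF this assms(2)]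
  show "f n $ r $ s = 0 $ r $ s" by simp
qed

lemma kk_eval_inj_0:
  assumes "\<And>a b. kk_eval P a b = 0"
  shows "P = 0"
proof (rule kk_eqI)
  fix x :: "nat \<times> nat"
  have fin: "finite (fst ` Poly_Mapping.keys P \<union> snd ` Poly_Mapping.keys P)" by simp
  obtain N where N: "\<And>y. y \<in> Poly_Mapping.keys P \<Longrightarrow> fst y < N \<and> snd y < N"
    using finite_nat_iff_bounded[THEN iffD1, OF fin] by (metis UnCI imageI lessThan_iff subsetD)
  have "kk_eval P a b = (\<Sum>y\<in>{..<N} \<times> {..<N}. (\<lambda>(m, n) u. mat_scale (a ^ m / fact m * (b ^ n / fact n)) u) y (Poly_Mapping.lookup P y))" for a b
    unfolding kk_eval_def using N by (intro lext_superset) auto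
  then have "(\<Sum>m<N. mat_scale (a ^ m / fact m) (\<Sum>n<N. mat_scale (b ^ n / fact n) (Poly_Mapping.lookup P (m, n)))) = 0" for a b
    using assms[of a b] by (simp add: mat_scale_sum sum.cartesian_product split_def)
  then have "(\<Sum>n<N. mat_scale (b ^ n / fact n) (Poly_Mapping.lookup P (m, n))) = 0" if "m < N" for m b
    using that series_inj[where N = N and f = "\<lambda>m. (\<Sum>n<N. mat_scale (b ^ n / fact n) (Poly_Mapping.lookup P (m, n)))"] by blast
  then have "Poly_Mapping.lookup P (m, n) = 0" if "m < N" "n < N" for m n
    using that series_inj[where N = N and f = "\<lambda>n. Poly_Mapping.lookup P (m, n)"] by blast
  then show "Poly_Mapping.lookup P x = Poly_Mapping.lookup 0 x"
    using N[of x] by (cases x) (auto simp: in_keys_iff)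
qed

lemma kk_eval_inj:
  assumes "\<And>a b. kk_eval P a b = kk_eval Q a b"
  shows "P = Q"
proof -
  have "kk_eval (P - Q) a b = 0" for a b
    using additive_minus[of "\<lambda>P. kk_eval P a b" P Q] assms by (simp add: kk_eval_add)
  from kk_eval_inj_0[OF this] show ?thesis by simp
qed

text \<open>
  \<open>kk_gen (Y\<^sup>+(u,z)v) x a b\<close> is the value at \<open>(a,b)\<close> of the \<open>\<lambda>\<close>-bracket of \<open>u\<close> and \<open>v\<close> at \<open>\<lambda> = x\<close>.
\<close>

definition kk_gen :: "(int \<Rightarrow>\<^sub>0 ('a::field_char_0, 'n::finite) kk) \<Rightarrow> 'a \<Rightarrow> 'a \<Rightarrow> 'a \<Rightarrow> 'a^'n^'n" where
  "kk_gen S x a b = lext (\<lambda>e P.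
     if e < 0 then mat_scale (x ^ nat (- e - 1) / fact (nat (- e - 1))) (kk_eval P a b) else 0) S"

lemma kk_gen_add: "kk_gen (S + T) x a b = kk_gen S x a b + kk_gen T x a b"
  unfolding kk_gen_def by (rule lext_add) (auto simp: mat_scale_algebra kk_eval_add)

lemma kk_gen_single: "kk_gen (Poly_Mapping.single e P) x a b =
    (if e < 0 then mat_scale (x ^ nat (- e - 1) / fact (nat (- e - 1))) (kk_eval P a b) else 0)"
  unfolding kk_gen_def by (rule lext_single) auto

lemma divided_power_binomial:
  fixes x y :: "'a::field_char_0"
  shows "(\<Sum>j\<le>n. x ^ j / fact j * (y ^ (n - j) / fact (n - j))) = (x + y) ^ n / fact n"
proof -
  have "(x + y) ^ n / fact n = (\<Sum>j\<le>n. of_nat (n choose j) * x ^ j * y ^ (n - j) / fact n)"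
    by (simp add: binomial_ring sum_divide_distrib)
  also have "\<dots> = (\<Sum>j\<le>n. x ^ j / fact j * (y ^ (n - j) / fact (n - j)))"
    by (rule sum.cong) (auto simp: binomial_fact field_simps)
  finally show ?thesis by simp
qed

lemma divided_power_binomial_shift:
  fixes x a :: "'a::field_char_0"
  assumes "m \<le> M"
  shows "(\<Sum>p\<le>M. x ^ (M - p) / fact (M - p) * (of_nat (p choose m) * (a ^ p / fact p)))
    = a ^ m / fact m * ((x + a) ^ (M - m) / fact (M - m))"
proof -
  have "(\<Sum>p\<le>M. x ^ (M - p) / fact (M - p) * (of_nat (p choose m) * (a ^ p / fact p)))
      = (\<Sum>p\<in>{m..M}. x ^ (M - p) / fact (M - p) * (of_nat (p choose m) * (a ^ p / fact p)))"
    by (rule sum.mono_neutral_right) (auto simp: binomial_eq_0)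
  also have "\<dots> = (\<Sum>j\<le>M - m. x ^ (M - m - j) / fact (M - m - j) * (of_nat ((m + j) choose m) * (a ^ (m + j) / fact (m + j))))"
    by (rule sum.reindex_bij_witness[of _ "\<lambda>j. m + j" "\<lambda>p. p - m"]) (use assms in auto)
  also have "\<dots> = (\<Sum>j\<le>M - m. a ^ m / fact m * (a ^ j / fact j * (x ^ (M - m - j) / fact (M - m - j))))"
    by (rule sum.cong) (auto simp: binomial_fact field_simps power_add)
  also have "\<dots> = a ^ m / fact m * ((x + a) ^ (M - m) / fact (M - m))"
    unfolding sum_distrib_left[symmetric] divided_power_binomial by (simp add: add.commute)
  finally show ?thesis .
qed

lemma coefficient_fact:
  assumes "i \<in> {0, 1 :: nat}"
  shows "(of_nat n * of_bool (i = 0) + 1) * ((- of_nat n - 1 - of_bool (i = 0) :: 'a::field_char_0) gchoose m)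
    = (- 1) ^ m * fact (n + m + of_bool (i = 0)) / (fact n * fact m)"
proof -
  let ?d = "of_bool (i = 0) :: nat"
  have "(- of_nat n - 1 - of_bool (i = 0) :: 'a) gchoose m = (- of_nat (n + 1 + ?d)) gchoose m"
    by (rule arg_cong2[where f = gbinomial]) simp_all
  also have "\<dots> = (- 1) ^ m * ((of_nat (n + 1 + ?d) + of_nat m - 1) gchoose m)"
    by (rule gbinomial_minus)
  also have "of_nat (n + 1 + ?d) + of_nat m - 1 = (of_nat (n + m + ?d) :: 'a)"
    by simp
  also have "\<dots> gchoose m = of_nat ((n + m + ?d) choose m)"
    by (simp add: binomial_gbinomial)
  also have "\<dots> = fact (n + m + ?d) / (fact m * fact (n + ?d))"
    by (subst binomial_fact) (auto simp: add.commute add.left_commute)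
  finally have *: "(- of_nat n - 1 - of_bool (i = 0) :: 'a) gchoose m
    = (- 1) ^ m * (fact (n + m + ?d) / (fact m * fact (n + ?d)))" .
  have **: "fact (n + ?d) = (of_nat n * of_bool (i = 0) + 1 :: 'a) * fact n"
    by (simp add: algebra_simps)
  have "(of_nat n * of_bool (i = 0) + 1 :: 'a) \<noteq> 0"
    using fact_nonzero[of "n + ?d", where ?'a = 'a] unfolding ** by auto
  moreover have "A * (s * (F / (C * (A * B)))) = s * F / (B * C)" if "A \<noteq> 0" for A s F B C :: 'a
    using that by (simp add: divide_simps)
  ultimately show ?thesis unfolding * ** by blast
qed

definition kk_factor :: "nat \<Rightarrow> 'a::field_char_0 \<Rightarrow> 'a" where
  "kk_factor i x = (if i = 0 then x else 1)"

lemma bracket_scalar: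
  fixes x a :: "'a::field_char_0" and m1 m2 n1 :: nat
  assumes i: "i \<in> {0, 1 :: nat}"
  defines "M \<equiv> m1 + m2 + n1 + of_bool (i = 0)"
  shows "(\<Sum>p\<le>M. x ^ (M - p) / fact (M - p) *
       ((of_nat n1 * of_bool (i = 0) + 1) * ((- of_nat n1 - 1 - of_bool (i = 0)) gchoose m2)
         * of_nat (p choose m1) * (a ^ p / fact p)))
     = kk_factor i (x + a) * (a ^ m1 / fact m1 * ((- x - a) ^ m2 / fact m2)) * ((x + a) ^ n1 / fact n1)"
proof -
  let ?K = "(of_nat n1 * of_bool (i = 0) + 1) * ((- of_nat n1 - 1 - of_bool (i = 0) :: 'a) gchoose m2)"
  have "(\<Sum>p\<le>M. x ^ (M - p) / fact (M - p) * (?K * of_nat (p choose m1) * (a ^ p / fact p)))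
     = ?K * (\<Sum>p\<le>M. x ^ (M - p) / fact (M - p) * (of_nat (p choose m1) * (a ^ p / fact p)))"
    by (simp add: sum_distrib_left mult_ac)
  also have "\<dots> = ?K * (a ^ m1 / fact m1 * ((x + a) ^ (M - m1) / fact (M - m1)))"
    by (subst divided_power_binomial_shift) (auto simp: M_def)
  also have "M - m1 = n1 + m2 + of_bool (i = 0)" by (simp add: M_def)
  also have "?K * (a ^ m1 / fact m1 * ((x + a) ^ (n1 + m2 + of_bool (i = 0)) / fact (n1 + m2 + of_bool (i = 0))))
     = (x + a) ^ of_bool (i = 0) * (a ^ m1 / fact m1 * ((-1) ^ m2 * (x + a) ^ m2 / fact m2)) * ((x + a) ^ n1 / fact n1)"
    unfolding coefficient_fact[OF i]
    by (simp add: field_simps power_add del: of_bool_eq fact_Suc)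
  also have "(-1) ^ m2 * (x + a) ^ m2 = (- x - a) ^ m2"
    by (simp flip: power_mult_distrib)
  also have "(x + a) ^ of_bool (i = 0) = kk_factor i (x + a)"
    by (simp add: kk_factor_def)
  finally show ?thesis .
qed

definition kk_bracket ::
  "nat \<Rightarrow> ('a::field_char_0 \<Rightarrow> 'a \<Rightarrow> 'a^'n^'n) \<Rightarrow> ('a \<Rightarrow> 'a \<Rightarrow> 'a^'n^'n) \<Rightarrow> 'a \<Rightarrow> 'a \<Rightarrow> 'a \<Rightarrow> 'a^'n^'n" where
  "kk_bracket i f g x a b =
     mat_scale (kk_factor i (x + a)) (f a (- x - a) ** g (x + a) b)
   - mat_scale (kk_factor i (- x - b)) (g a (x + b) ** f (- x - b) b)"

lemma kk_gen_Y_elt: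
  assumes i: "i \<in> {0, 1 :: nat}"
  shows "kk_gen (kk_Y_elt i u m1 m2 v n1 n2) x a b
    = kk_bracket i (kk_eval (elt u m1 m2)) (kk_eval (elt v n1 n2)) x a b"
proof -
  let ?d = "of_bool (i = 0) :: nat"
  let ?M = "m1 + m2 + n1 + ?d"
  let ?N = "m2 + m1 + n2 + ?d"
  let ?K = "(of_nat n1 * of_bool (i = 0) + 1) * ((- of_nat n1 - 1 - of_bool (i = 0) :: 'a) gchoose m2)"
  let ?K' = "(of_bool (i = 1) - (of_nat n2 + 1) * of_bool (i = 0)) * ((- of_nat n2 - 1 - of_bool (i = 0) :: 'a) gchoose m1)"
  let ?K'' = "(of_nat n2 * of_bool (i = 0) + 1) * ((- of_nat n2 - 1 - of_bool (i = 0) :: 'a) gchoose m1)"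
  have K': "?K' = (if i = 0 then -1 else 1) * ?K''"
    using i by auto
  have "kk_gen (\<Sum>p\<le>?M. Poly_Mapping.single (int p - int m1 - int m2 - int n1 - 1 - of_bool (i = 0))
          (kk_scale (?K * of_nat (p choose m1)) (elt (u ** v) p n2))) x a b
      = (\<Sum>p\<le>?M. mat_scale (x ^ (?M - p) / fact (?M - p) * (?K * of_nat (p choose m1) * (a ^ p / fact p)) * (b ^ n2 / fact n2)) (u ** v))"
    unfolding additive_sum[of "\<lambda>S. kk_gen S x a b", OF kk_gen_add]
  proof (rule sum.cong[OF refl])
    fix p assume "p \<in> {..?M}"
    then have "nat (- (int p - int m1 - int m2 - int n1 - 1 - of_bool (i = 0)) - 1) = ?M - p"
      and "int p - int m1 - int m2 - int n1 - 1 - of_bool (i = 0) < 0" by auto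
    then show "kk_gen (Poly_Mapping.single (int p - int m1 - int m2 - int n1 - 1 - of_bool (i = 0))
          (kk_scale (?K * of_nat (p choose m1)) (elt (u ** v) p n2))) x a b
      = mat_scale (x ^ (?M - p) / fact (?M - p) * (?K * of_nat (p choose m1) * (a ^ p / fact p)) * (b ^ n2 / fact n2)) (u ** v)"
      unfolding kk_gen_single kk_eval_scale kk_eval_elt by (simp only: if_True mat_scale_simps mult_ac)
  qed
  also have "\<dots> = mat_scale (kk_factor i (x + a) * (a ^ m1 / fact m1 * ((- x - a) ^ m2 / fact m2)) * ((x + a) ^ n1 / fact n1) * (b ^ n2 / fact n2)) (u ** v)"
    unfolding mat_scale_sum_left[symmetric] sum_distrib_right[symmetric] bracket_scalar[OF i] ..
  finally have 1: "kk_gen (\<Sum>p\<le>?M. Poly_Mapping.single (int p - int m1 - int m2 - int n1 - 1 - of_bool (i = 0))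
          (kk_scale (?K * of_nat (p choose m1)) (elt (u ** v) p n2))) x a b = \<dots>" .
  have "kk_gen (\<Sum>q\<le>m1 + m2 + n2 + of_bool (i = 0). Poly_Mapping.single (int q - int m1 - int m2 - int n2 - 1 - of_bool (i = 0))
          (kk_scale (?K' * of_nat (q choose m2)) (elt (v ** u) n1 q))) x a b
      = (\<Sum>q\<le>?N. mat_scale ((if i = 0 then -1 else 1) * (x ^ (?N - q) / fact (?N - q) * (?K'' * of_nat (q choose m2) * (b ^ q / fact q)) * (a ^ n1 / fact n1))) (v ** u))"
    unfolding additive_sum[of "\<lambda>S. kk_gen S x a b", OF kk_gen_add]
  proof (rule sum.cong)
    fix q assume "q \<in> {..?N}"
    then have "nat (- (int q - int m1 - int m2 - int n2 - 1 - of_bool (i = 0)) - 1) = ?N - q"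
      and "int q - int m1 - int m2 - int n2 - 1 - of_bool (i = 0) < 0" by auto
    then show "kk_gen (Poly_Mapping.single (int q - int m1 - int m2 - int n2 - 1 - of_bool (i = 0))
          (kk_scale (?K' * of_nat (q choose m2)) (elt (v ** u) n1 q))) x a b
      = mat_scale ((if i = 0 then -1 else 1) * (x ^ (?N - q) / fact (?N - q) * (?K'' * of_nat (q choose m2) * (b ^ q / fact q)) * (a ^ n1 / fact n1))) (v ** u)"
      unfolding kk_gen_single kk_eval_scale kk_eval_elt K' by (simp only: if_True mat_scale_simps mult_ac)
  qed simp
  also have "\<dots> = mat_scale ((if i = 0 then -1 else 1) * (kk_factor i (x + b) * (b ^ m2 / fact m2 * ((- x - b) ^ m1 / fact m1)) * ((x + b) ^ n2 / fact n2) * (a ^ n1 / fact n1))) (v ** u)"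
    unfolding mat_scale_sum_left[symmetric] sum_distrib_right[symmetric] sum_distrib_left[symmetric] bracket_scalar[OF i] ..
  also have "\<dots> = mat_scale (kk_factor i (- x - b) * (b ^ m2 / fact m2 * ((- x - b) ^ m1 / fact m1)) * ((x + b) ^ n2 / fact n2) * (a ^ n1 / fact n1)) (v ** u)"
  proof -
    have "(if i = 0 then -1 else 1) * kk_factor i (x + b) = kk_factor i (- x - b)"
      by (simp add: kk_factor_def)
    then show ?thesis by (simp only: mult.assoc[symmetric])
  qed
  finally have 2: "kk_gen (\<Sum>q\<le>m1 + m2 + n2 + of_bool (i = 0). Poly_Mapping.single (int q - int m1 - int m2 - int n2 - 1 - of_bool (i = 0))
          (kk_scale (?K' * of_nat (q choose m2)) (elt (v ** u) n1 q))) x a b = \<dots>" .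
  show ?thesis
    unfolding kk_Y_elt_def additive_minus[of "\<lambda>S. kk_gen S x a b", OF kk_gen_add] 1 2
    by (simp add: kk_bracket_def kk_eval_elt mat_scale_mult mult_ac)
qed

lemma kk_bracket_linear:
  "kk_bracket i (\<lambda>a b. f a b + f' a b) g x a b = kk_bracket i f g x a b + kk_bracket i f' g x a b"
  "kk_bracket i f (\<lambda>a b. g a b + g' a b) x a b = kk_bracket i f g x a b + kk_bracket i f g' x a b"
  "kk_bracket i (\<lambda>a b. mat_scale c (f a b)) g x a b = mat_scale c (kk_bracket i f g x a b)"
  "kk_bracket i f (\<lambda>a b. mat_scale c (g a b)) x a b = mat_scale c (kk_bracket i f g x a b)"
  "kk_bracket i (\<lambda>a b. 0) g x a b = 0"
  "kk_bracket i f (\<lambda>a b. 0) x a b = 0"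
  by (simp_all add: kk_bracket_def matrix_mult_algebra mat_scale_algebra mat_scale_mult mult_ac)

lemma kk_bracket_sum:
  "kk_bracket i (\<lambda>a b. \<Sum>n\<in>A. f n a b) g x a b = (\<Sum>n\<in>A. kk_bracket i (f n) g x a b)"
  "kk_bracket i g (\<lambda>a b. \<Sum>n\<in>A. f n a b) x a b = (\<Sum>n\<in>A. kk_bracket i g (f n) x a b)"
  by (induction A rule: infinite_finite_induct) (simp_all add: kk_bracket_linear)

lemma kk_gen_Y:
  assumes i: "i \<in> {0, 1 :: nat}"
  shows "kk_gen (kk_Y i P Q) x a b = kk_bracket i (kk_eval P) (kk_eval Q) x a b"
proof (induction P rule: kk_induct)
  case (elt u m1 m2)
  show ?case
  proof (induction Q rule: kk_induct)
    case (elt v n1 n2)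
    show ?case unfolding kk_Y_elt_elt by (rule kk_gen_Y_elt[OF i])
  qed (simp add: kk_Y_add_right kk_gen_add kk_eval_add[abs_def] kk_bracket_linear)
qed (simp add: kk_Y_add_left kk_gen_add kk_eval_add[abs_def] kk_bracket_linear)

lemma kk_bracket_jacobi:
  "kk_bracket i f (kk_bracket i g h y) x a b - kk_bracket i g (kk_bracket i f h x) y a b
    = kk_bracket i (kk_bracket i f g x) h (x + y) a b"
proof -
  have *: "- y - (a + x) = - x - (a + y)" "- a - y = - y - a" "- b - y = - y - b"
    "- y - (b + x) = - x - (b + y)" by simp_all
  show ?thesis
    by (simp add: kk_bracket_def matrix_mult_algebra mat_scale_algebra mat_scale_mult
        matrix_mul_assoc[symmetric] mult_ac add_ac algebra_simps *)
qed

lemma kk_bracket_skew: "kk_bracket i g f (- x - a - b) a b = - kk_bracket i f g x a b"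
proof -
  have *: "- a - x = - x - a" "- b - x = - x - b" by simp_all
  show ?thesis by (simp add: kk_bracket_def algebra_simps *)
qed

lemma kk_bracket_deriv: "kk_bracket i (\<lambda>a b. mat_scale (a + b) (f a b)) g x a b = mat_scale (- x) (kk_bracket i f g x a b)"
  by (simp add: kk_bracket_def mat_scale_algebra mat_scale_mult matrix_mult_algebra mult_ac)

abbreviation kk_nprod :: "nat \<Rightarrow> ('a::field_char_0, 'n::finite) kk \<Rightarrow> nat \<Rightarrow> ('a, 'n) kk \<Rightarrow> ('a, 'n) kk" where
  "kk_nprod i P n Q \<equiv> Poly_Mapping.lookup (kk_Y i P Q) (- int n - 1)"

lemma kk_nprod_add:
  "kk_nprod i (P + P') n Q = kk_nprod i P n Q + kk_nprod i P' n Q"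
  "kk_nprod i P n (Q + Q') = kk_nprod i P n Q + kk_nprod i P n Q'"
  by (simp_all add: kk_Y_add_left kk_Y_add_right lookup_add)

lemma kk_nprod_scale:
  "kk_nprod i (kk_scale c P) n Q = kk_scale c (kk_nprod i P n Q)"
  "kk_nprod i P n (kk_scale c Q) = kk_scale c (kk_nprod i P n Q)"
  by (simp_all add: kk_Y_scale_left kk_Y_scale_right lookup_map_0)

lemma kk_Y_0 [simp]: "kk_Y i 0 Q = 0" "kk_Y i P 0 = 0"
  by (simp_all add: kk_Y_def)

lemma kk_nprod_bound: "\<exists>N. \<forall>n\<ge>N. kk_nprod i P n Q = 0"
proof -
  let ?A = "(\<lambda>e. nat (- e - 1)) ` Poly_Mapping.keys (kk_Y i P Q)"
  have "finite ?A" by simp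
  then obtain N where "?A \<subseteq> {..<N}" using finite_nat_iff_bounded by blast
  moreover have "n \<in> ?A" if "kk_nprod i P n Q \<noteq> 0" for n
    using that by (intro image_eqI[of _ _ "- int n - 1"]) (auto simp: in_keys_iff)
  ultimately show ?thesis by (metis lessThan_iff not_le subsetD)
qed

lemma kk_gen_bounded:
  assumes "\<And>n. n \<ge> N \<Longrightarrow> Poly_Mapping.lookup S (- int n - 1) = 0"
  shows "kk_gen S x a b
    = (\<Sum>n<N. mat_scale (x ^ n / fact n) (kk_eval (Poly_Mapping.lookup S (- int n - 1)) a b))"
proof -
  let ?f = "\<lambda>e P. if e < 0 then mat_scale (x ^ nat (- e - 1) / fact (nat (- e - 1))) (kk_eval P a b) else 0"
  let ?g = "\<lambda>n. - int n - 1"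
  let ?A = "Poly_Mapping.keys S \<union> ?g ` {..<N}"
  have "kk_gen S x a b = (\<Sum>e\<in>?A. ?f e (Poly_Mapping.lookup S e))"
    unfolding kk_gen_def by (rule lext_superset) auto
  also have "\<dots> = (\<Sum>e\<in>?g ` {..<N}. ?f e (Poly_Mapping.lookup S e))"
  proof (rule sum.mono_neutral_right)
    show "\<forall>e\<in>?A - ?g ` {..<N}. ?f e (Poly_Mapping.lookup S e) = 0"
    proof
      fix e assume e: "e \<in> ?A - ?g ` {..<N}"
      show "?f e (Poly_Mapping.lookup S e) = 0"
      proof (cases "e < 0")
        case True
        then have *: "e = ?g (nat (- e - 1))" by simp
        with e have "nat (- e - 1) \<ge> N" by (metis DiffE imageI lessThan_iff not_le)
        from assms[OF this] * have "Poly_Mapping.lookup S e = 0" by metis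
        then show ?thesis by simp
      qed simp
    qed
  qed auto
  also have "\<dots> = (\<Sum>n<N. mat_scale (x ^ n / fact n) (kk_eval (Poly_Mapping.lookup S (?g n)) a b))"
    by (subst sum.reindex) (auto simp: inj_on_def)
  finally show ?thesis .
qed

lemma kk_series_inj:
  assumes "\<And>x a b. (\<Sum>n<N. mat_scale (x ^ n / fact n) (kk_eval (X n) a b))
      = (\<Sum>n<N. mat_scale (x ^ n / fact n) (kk_eval (Z n) a b))" and "n < N"
  shows "X n = Z n"
proof (rule kk_eval_inj)
  fix a b
  have "(\<Sum>n<N. mat_scale (x ^ n / fact n) (kk_eval (X n) a b - kk_eval (Z n) a b)) = 0" for x
    using assms(1)[of x a b] by (simp add: mat_scale_algebra sum_subtractf)
  from series_inj[where f = "\<lambda>n. kk_eval (X n) a b - kk_eval (Z n) a b", OF this assms(2)]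
  show "kk_eval (X n) a b = kk_eval (Z n) a b" by simp
qed

lemma kk_bracket_series:
  assumes i: "i \<in> {0, 1 :: nat}" and N: "\<And>n. n \<ge> N \<Longrightarrow> kk_nprod i P n Q = 0"
  shows "(\<Sum>n<N. mat_scale (x ^ n / fact n) (kk_eval (kk_nprod i P n Q) a b))
    = kk_bracket i (kk_eval P) (kk_eval Q) x a b"
  using kk_gen_bounded[of N "kk_Y i P Q", OF N] kk_gen_Y[OF i] by metis

lemma kk_derivative:
  assumes i: "i \<in> {0, 1 :: nat}"
  shows "kk_nprod i (kk_deriv P) n Q
    = (if n = 0 then 0 else kk_scale (- of_nat n) (kk_nprod i P (n - 1) Q))"
proof -
  let ?Z = "\<lambda>n. if n = 0 then 0 else kk_scale (- of_nat n) (kk_nprod i P (n - 1) Q)"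
  obtain N1 where N1: "\<And>n. n \<ge> N1 \<Longrightarrow> kk_nprod i P n Q = 0" using kk_nprod_bound by blast
  obtain N2 where N2: "\<And>n. n \<ge> N2 \<Longrightarrow> kk_nprod i (kk_deriv P) n Q = 0" using kk_nprod_bound by blast
  define N where "N = N1 + N2 + n"
  have "kk_nprod i (kk_deriv P) n Q = ?Z n"
  proof (rule kk_series_inj[where N = "Suc N" and X = "\<lambda>n. kk_nprod i (kk_deriv P) n Q" and Z = ?Z])
    fix x a b
    have "(\<Sum>n<Suc N. mat_scale (x ^ n / fact n) (kk_eval (kk_nprod i (kk_deriv P) n Q) a b))
        = kk_bracket i (kk_eval (kk_deriv P)) (kk_eval Q) x a b"
      by (rule kk_bracket_series[OF i]) (auto intro: N2 simp: N_def)
    also have "\<dots> = mat_scale (- x) (kk_bracket i (kk_eval P) (kk_eval Q) x a b)"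
      by (simp add: kk_eval_deriv[abs_def] kk_bracket_deriv)
    also have "\<dots> = mat_scale (- x) (\<Sum>n<N. mat_scale (x ^ n / fact n) (kk_eval (kk_nprod i P n Q) a b))"
      by (subst kk_bracket_series[OF i]) (auto intro: N1 simp: N_def)
    also have "\<dots> = (\<Sum>n<N. mat_scale (x ^ Suc n / fact (Suc n)) (kk_eval (?Z (Suc n)) a b))"
      unfolding mat_scale_sum
    proof (rule sum.cong[OF refl])
      fix m
      have "- x * (x ^ m / fact m) = - ((of_nat m + 1) * (x * x ^ m / fact (Suc m)))"
        unfolding fact_Suc_div by simp
      also have "\<dots> = x ^ Suc m / fact (Suc m) * (- of_nat (Suc m))"
      proof -
        have "- ((of_nat m + 1) * d) = d * (- of_nat (Suc m))" for d :: 'a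
          by (simp add: algebra_simps)
        then show ?thesis by (simp only: power_Suc)
      qed
      finally have "- x * (x ^ m / fact m) = \<dots>" .
      then show "mat_scale (- x) (mat_scale (x ^ m / fact m) (kk_eval (kk_nprod i P m Q) a b))
        = mat_scale (x ^ Suc m / fact (Suc m)) (kk_eval (?Z (Suc m)) a b)"
        by (simp only: kk_eval_scale mat_scale_simps if_False nat.simps diff_Suc_1)
    qed
    also have "\<dots> = (\<Sum>n<Suc N. mat_scale (x ^ n / fact n) (kk_eval (?Z n) a b))"
      by (subst sum.lessThan_Suc_shift) simp
    finally show "(\<Sum>n<Suc N. mat_scale (x ^ n / fact n) (kk_eval (kk_nprod i (kk_deriv P) n Q) a b)) = \<dots>" .
  qed (simp add: N_def)
  then show ?thesis .
qed

lemma kk_deriv_0 [simp]: "kk_deriv 0 = 0"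
  by (simp add: kk_deriv_def)

lemma kk_deriv_pow_0 [simp]: "(kk_deriv ^^ k) 0 = 0"
  by (induction k) simp_all

lemma kk_eval_sum: "kk_eval (sum f A) a b = (\<Sum>x\<in>A. kk_eval (f x) a b)"
  by (rule additive_sum[of "\<lambda>P. kk_eval P a b"]) (rule kk_eval_add)

lemma triangle_sum:
  fixes t :: "nat \<Rightarrow> nat \<Rightarrow> 'b::comm_monoid_add"
  assumes "\<And>n k. n + k \<ge> N \<Longrightarrow> t n k = 0"
  shows "(\<Sum>(n, k)\<in>{..<N} \<times> {..<N}. t n k) = (\<Sum>m<N. \<Sum>n\<le>m. t n (m - n))"
proof -
  have "(\<Sum>(n, k)\<in>{..<N} \<times> {..<N}. t n k) = (\<Sum>(n, k)\<in>{(n, k). n + k < N}. t n k)"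
    by (rule sum.mono_neutral_right) (auto intro: assms)
  also have "\<dots> = (\<Sum>m<N. \<Sum>n\<le>m. t n (m - n))"
    by (rule sum.triangle_reindex)
  finally show ?thesis .
qed

lemma kk_skew:
  assumes i: "i \<in> {0, 1 :: nat}"
  shows "kk_nprod i P n Q
    = Sum_any (\<lambda>k. kk_scale ((-1) ^ (n + k + 1) / fact k) ((kk_deriv ^^ k) (kk_nprod i Q (n + k) P)))"
proof -
  obtain N1 where N1: "\<And>n. n \<ge> N1 \<Longrightarrow> kk_nprod i P n Q = 0" using kk_nprod_bound by blast
  obtain N2 where N2: "\<And>n. n \<ge> N2 \<Longrightarrow> kk_nprod i Q n P = 0" using kk_nprod_bound by blast
  define N where "N = Suc (N1 + N2 + n)"
  let ?t = "\<lambda>n k. kk_scale ((-1) ^ (n + k + 1) / fact k) ((kk_deriv ^^ k) (kk_nprod i Q (n + k) P))"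
  have t0: "?t n k = 0" if "n + k \<ge> N" for n k
    using N2[of "n + k"] that by (simp add: N_def kk.scale_zero_right)
  have "kk_nprod i P n Q = (\<Sum>k<N. ?t n k)"
  proof (rule kk_series_inj[where N = N and X = "\<lambda>n. kk_nprod i P n Q" and Z = "\<lambda>n. \<Sum>k<N. ?t n k"])
    fix x a b
    let ?g = "\<lambda>n k. mat_scale (x ^ n / fact n) (kk_eval (?t n k) a b)"
    have "(\<Sum>n<N. mat_scale (x ^ n / fact n) (kk_eval (\<Sum>k<N. ?t n k) a b)) = (\<Sum>(n, k)\<in>{..<N} \<times> {..<N}. ?g n k)"
      by (simp only: kk_eval_sum mat_scale_sum sum.cartesian_product)
    also have "\<dots> = (\<Sum>m<N. \<Sum>n\<le>m. ?g n (m - n))"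
      by (rule triangle_sum) (simp only: t0 kk_eval_0 mat_scale_simps)
    also have "\<dots> = (\<Sum>m<N. mat_scale (-1) (mat_scale ((- x - a - b) ^ m / fact m) (kk_eval (kk_nprod i Q m P) a b)))"
    proof (rule sum.cong[OF refl])
      fix m
      have "(\<Sum>n\<le>m. ?g n (m - n))
          = (\<Sum>n\<le>m. mat_scale ((-1) ^ (m + 1) * (x ^ n / fact n * ((a + b) ^ (m - n) / fact (m - n)))) (kk_eval (kk_nprod i Q m P) a b))"
      proof (rule sum.cong[OF refl])
        fix n assume "n \<in> {..m}"
        then have nm: "n + (m - n) = m" by simp
        have "x ^ n / fact n * ((- 1) ^ (m + 1) / fact (m - n) * (a + b) ^ (m - n))
            = (-1) ^ (m + 1) * (x ^ n / fact n * ((a + b) ^ (m - n) / fact (m - n)))"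
          by (simp_all only: times_divide_eq_left times_divide_eq_right divide_divide_eq_left mult_ac)
        then show "?g n (m - n) = mat_scale ((-1) ^ (m + 1) * (x ^ n / fact n * ((a + b) ^ (m - n) / fact (m - n)))) (kk_eval (kk_nprod i Q m P) a b)"
          unfolding nm kk_eval_scale kk_eval_deriv_pow mat_scale_simps mult.assoc by (simp only:)
      qed
      also have "\<dots> = mat_scale ((-1) ^ (m + 1) * ((x + (a + b)) ^ m / fact m)) (kk_eval (kk_nprod i Q m P) a b)"
        unfolding mat_scale_sum_left[symmetric] sum_distrib_left[symmetric] divided_power_binomial ..
      also have "(-1) ^ (m + 1) * ((x + (a + b)) ^ m / fact m) = -1 * ((-1 * (x + (a + b))) ^ m / fact m)"
        unfolding power_mult_distrib by simp
      also have "-1 * (x + (a + b)) = - x - a - b" by simp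
      finally show "(\<Sum>n\<le>m. ?g n (m - n)) = mat_scale (-1) (mat_scale ((- x - a - b) ^ m / fact m) (kk_eval (kk_nprod i Q m P) a b))"
        by (simp only: mat_scale_simps)
    qed
    also have "\<dots> = mat_scale (-1) (kk_bracket i (kk_eval Q) (kk_eval P) (- x - a - b) a b)"
      unfolding mat_scale_sum[symmetric]
      by (subst kk_bracket_series[OF i]) (auto intro: N2 simp: N_def)
    also have "\<dots> = kk_bracket i (kk_eval P) (kk_eval Q) x a b"
      unfolding kk_bracket_skew by (simp add: mat_scale_algebra)
    also have "\<dots> = (\<Sum>n<N. mat_scale (x ^ n / fact n) (kk_eval (kk_nprod i P n Q) a b))"
      by (subst kk_bracket_series[OF i]) (auto intro: N1 simp: N_def)
    finally show "(\<Sum>n<N. mat_scale (x ^ n / fact n) (kk_eval (kk_nprod i P n Q) a b)) =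
         (\<Sum>n<N. mat_scale (x ^ n / fact n) (kk_eval (\<Sum>k<N. ?t n k) a b))" by simp
  qed (simp add: N_def)
  also have "\<dots> = Sum_any (?t n)"
  proof (rule Sum_any.expand_superset[symmetric])
    show "{k. ?t n k \<noteq> 0} \<subseteq> {..<N}"
    proof
      fix k assume "k \<in> {k. ?t n k \<noteq> 0}"
      then have "\<not> N \<le> n + k" using t0[of n k] by blast
      then show "k \<in> {..<N}" by simp
    qed
  qed simp
  finally show ?thesis .
qed

lemma kk_nprod_sum: "kk_nprod i P n (sum f A) = (\<Sum>x\<in>A. kk_nprod i P n (f x))"
    "kk_nprod i (sum f A) n P = (\<Sum>x\<in>A. kk_nprod i (f x) n P)"
  by (rule additive_sum[of "\<lambda>Q. kk_nprod i P n Q"], rule kk_nprod_add)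
     (rule additive_sum[of "\<lambda>Q. kk_nprod i Q n P"], rule kk_nprod_add)

lemma kk_nprod_0 [simp]: "kk_nprod i P n 0 = 0" "kk_nprod i 0 n P = 0"
  by simp_all

lemma kk_uniform_bound:
  fixes M :: nat
  shows "\<exists>N. \<forall>m<M. \<forall>n\<ge>N. kk_nprod i (f m) n (g m) = 0"
proof (induction M)
  case (Suc M)
  then obtain N1 where N1: "\<forall>m<M. \<forall>n\<ge>N1. kk_nprod i (f m) n (g m) = 0" by blast
  obtain N2 where N2: "\<forall>n\<ge>N2. kk_nprod i (f M) n (g M) = 0" using kk_nprod_bound by blast
  show ?case
  proof (intro exI allI impI)
    fix m n assume "m < Suc M" "max N1 N2 \<le> n"
    then show "kk_nprod i (f m) n (g m) = 0" using N1 N2 by (cases "m = M") (simp_all add: less_Suc_eq)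
  qed
qed simp

lemma kk_nested_bound:
  "\<exists>N. (\<forall>n\<ge>N. kk_nprod i P n Q = 0) \<and> (\<forall>m n. n \<ge> N \<longrightarrow> kk_nprod i T n (kk_nprod i P m Q) = 0)
     \<and> (\<forall>m n. n \<ge> N \<longrightarrow> kk_nprod i (kk_nprod i P m Q) n T = 0)"
proof -
  obtain N1 where N1: "\<forall>n\<ge>N1. kk_nprod i P n Q = 0" using kk_nprod_bound by blast
  obtain N2 where N2: "\<forall>m<N1. \<forall>n\<ge>N2. kk_nprod i T n (kk_nprod i P m Q) = 0"
    using kk_uniform_bound[of N1 i "\<lambda>_. T" "\<lambda>m. kk_nprod i P m Q"] by (elim exE)
  obtain N3 where N3: "\<forall>m<N1. \<forall>n\<ge>N3. kk_nprod i (kk_nprod i P m Q) n T = 0"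
    using kk_uniform_bound[of N1 i "\<lambda>m. kk_nprod i P m Q" "\<lambda>_. T"] by (elim exE)
  show ?thesis
  proof (rule exI[of _ "N1 + N2 + N3"], intro conjI allI impI)
    fix m n assume n: "n \<ge> N1 + N2 + N3"
    show "kk_nprod i T n (kk_nprod i P m Q) = 0"
    proof (cases "m < N1")
      case True
      with N2 n show ?thesis by simp
    next
      case False
      then have "kk_nprod i P m Q = 0" using N1 by simp
      then show ?thesis by (simp only: kk_nprod_0)
    qed
    show "kk_nprod i (kk_nprod i P m Q) n T = 0"
    proof (cases "m < N1")
      case True
      with N3 n show ?thesis by simp
    next
      case False
      then have "kk_nprod i P m Q = 0" using N1 by simp
      then show ?thesis by (simp only: kk_nprod_0)
    qed
  next
    fix n assume "n \<ge> N1 + N2 + N3"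
    then show "kk_nprod i P n Q = 0" using N1 by simp
  qed
qed

lemma kk_double_series:
  assumes i: "i \<in> {0, 1 :: nat}"
    and 1: "\<And>n. n \<ge> N \<Longrightarrow> kk_nprod i Q n T = 0"
    and 2: "\<And>m n. n \<ge> N \<Longrightarrow> kk_nprod i P n (kk_nprod i Q m T) = 0"
  shows "(\<Sum>m<N. mat_scale (x ^ m / fact m) (\<Sum>n<N. mat_scale (y ^ n / fact n)
            (kk_eval (kk_nprod i P m (kk_nprod i Q n T)) a b)))
    = kk_bracket i (kk_eval P) (kk_bracket i (kk_eval Q) (kk_eval T) y) x a b"
proof -
  have "(\<Sum>m<N. mat_scale (x ^ m / fact m) (\<Sum>n<N. mat_scale (y ^ n / fact n)
            (kk_eval (kk_nprod i P m (kk_nprod i Q n T)) a b)))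
      = (\<Sum>n<N. mat_scale (y ^ n / fact n) (\<Sum>m<N. mat_scale (x ^ m / fact m)
            (kk_eval (kk_nprod i P m (kk_nprod i Q n T)) a b)))"
    unfolding mat_scale_sum by (subst sum.swap) (simp only: mat_scale_simps mult_ac)
  also have "\<dots> = (\<Sum>n<N. mat_scale (y ^ n / fact n) (kk_bracket i (kk_eval P) (kk_eval (kk_nprod i Q n T)) x a b))"
    by (subst kk_bracket_series[OF i]) (auto intro: 2)
  also have "\<dots> = kk_bracket i (kk_eval P) (\<lambda>a b. \<Sum>n<N. mat_scale (y ^ n / fact n) (kk_eval (kk_nprod i Q n T) a b)) x a b"
    by (simp only: kk_bracket_sum kk_bracket_linear)
  also have "\<dots> = kk_bracket i (kk_eval P) (kk_bracket i (kk_eval Q) (kk_eval T) y) x a b"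
    by (simp only: kk_bracket_series[OF i 1])
  finally show ?thesis .
qed

lemma commutator_reindex:
  fixes z :: "nat \<Rightarrow> nat \<Rightarrow> 'a::field_char_0^'n^'n"
  assumes z: "\<And>m n. m \<ge> N \<Longrightarrow> z m n = 0" "\<And>m n. n \<ge> N \<Longrightarrow> z m n = 0"
  shows "(\<Sum>r<N + N. mat_scale (x ^ r / fact r) (\<Sum>s<N + N. mat_scale (y ^ s / fact s)
            (\<Sum>j\<le>r. mat_scale (of_nat (r choose j)) (z (r - j) (s + j)))))
    = (\<Sum>m<N. mat_scale (x ^ m / fact m) (\<Sum>n<N. mat_scale ((x + y) ^ n / fact n) (z m n)))"
proof -
  let ?h = "\<lambda>r s j. mat_scale (x ^ r / fact r * (y ^ s / fact s) * of_nat (r choose j)) (z (r - j) (s + j))"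
  let ?k = "\<lambda>m n j. mat_scale (x ^ m / fact m * (x ^ j / fact j * (y ^ (n - j) / fact (n - j)))) (z m n)"
  let ?A = "SIGMA r:{..<N + N}. SIGMA s:{..<N + N}. {..r}"
  let ?A' = "{(r, s, j). j \<le> r \<and> r - j < N \<and> s + j < N}"
  let ?B = "SIGMA m:{..<N}. SIGMA n:{..<N}. {..n}"
  have "(\<Sum>r<N + N. mat_scale (x ^ r / fact r) (\<Sum>s<N + N. mat_scale (y ^ s / fact s)
            (\<Sum>j\<le>r. mat_scale (of_nat (r choose j)) (z (r - j) (s + j)))))
      = (\<Sum>r<N + N. \<Sum>s<N + N. \<Sum>j\<le>r. ?h r s j)"
    by (simp only: mat_scale_sum mat_scale_simps mult.assoc)
  also have "\<dots> = (\<Sum>(r, s, j)\<in>?A. ?h r s j)"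
    by (simp add: sum.Sigma)
  also have "\<dots> = (\<Sum>(r, s, j)\<in>?A'. ?h r s j)"
  proof (rule sum.mono_neutral_right)
    show "\<forall>p\<in>?A - ?A'. (case p of (r, s, j) \<Rightarrow> ?h r s j) = 0"
    proof
      fix p assume p: "p \<in> ?A - ?A'"
      obtain r s j where [simp]: "p = (r, s, j)" by (cases p)
      from p have "r - j \<ge> N \<or> s + j \<ge> N" by auto
      then have "z (r - j) (s + j) = 0" using z by blast
      then show "(case p of (r, s, j) \<Rightarrow> ?h r s j) = 0" by simp
    qed
  qed auto
  also have "\<dots> = (\<Sum>(m, n, j)\<in>?B. ?k m n j)"
  proof (rule sum.reindex_bij_witness[of _ "\<lambda>(m, n, j). (m + j, n - j, j)" "\<lambda>(r, s, j). (r - j, s + j, j)"])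
    fix p assume p: "p \<in> ?A'"
    obtain r s j where [simp]: "p = (r, s, j)" by (cases p)
    from p have "j \<le> r" by simp
    then have *: "x ^ r / fact r * of_nat (r choose j) = x ^ (r - j) / fact (r - j) * (x ^ j / fact j)"
      by (simp add: binomial_fact flip: power_add)
    have "x ^ r / fact r * (y ^ s / fact s) * of_nat (r choose j)
        = x ^ r / fact r * of_nat (r choose j) * (y ^ s / fact s)"
      by (simp only: mult_ac)
    also have "\<dots> = x ^ (r - j) / fact (r - j) * (x ^ j / fact j * (y ^ s / fact s))"
      unfolding * by (simp only: mult.assoc)
    finally have "x ^ r / fact r * (y ^ s / fact s) * of_nat (r choose j) = \<dots>" .
    then show "(case (case p of (r, s, j) \<Rightarrow> (r - j, s + j, j)) of (m, n, j) \<Rightarrow> ?k m n j) = (case p of (r, s, j) \<Rightarrow> ?h r s j)"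
      by simp
  qed auto
  also have "\<dots> = (\<Sum>m<N. \<Sum>n<N. \<Sum>j\<le>n. ?k m n j)"
    by (simp add: sum.Sigma)
  also have "\<dots> = (\<Sum>m<N. \<Sum>n<N. mat_scale (x ^ m / fact m * ((x + y) ^ n / fact n)) (z m n))"
    unfolding mat_scale_sum_left[symmetric] sum_distrib_left[symmetric] divided_power_binomial ..
  finally show ?thesis by (simp only: mat_scale_sum mat_scale_simps)
qed

lemma elt_in_kk_R: "l = 1 \<or> n \<ge> l - 2 \<Longrightarrow> elt u m n \<in> kk_R l"
  unfolding kk_R_def by (auto intro!: kk.span_base)

lemma subspace_kk_R: "module.subspace kk_scale (kk_R l)"
  by (simp add: kk_R_def)

lemma kk_R_induct [consumes 1, case_names subspace elt]:
  assumes "P \<in> kk_R l" "module.subspace kk_scale (Collect Q)"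
    "\<And>u m n. l = 1 \<or> n \<ge> l - 2 \<Longrightarrow> Q (elt u m n)"
  shows "Q P"
  using assms(1) unfolding kk_R_def
  by (auto split: if_splits intro: kk.span_induct[of P _ Q] simp: assms(2,3))

lemma kk_R_deriv: "P \<in> kk_R l \<Longrightarrow> kk_deriv P \<in> kk_R l"
proof (induction rule: kk_R_induct)
  case subspace
  show ?case
    by (intro kk.subspaceI) (auto simp: kk_deriv_add kk_deriv_scale kk.subspace_0[OF subspace_kk_R]
        kk.subspace_add[OF subspace_kk_R] kk.subspace_scale[OF subspace_kk_R])
next
  case (elt u m n)
  have "elt u (m + 1) n \<in> kk_R l" "elt u m (n + 1) \<in> kk_R l"
    using elt by (auto intro!: elt_in_kk_R)
  then show ?case
    unfolding kk_deriv_elt by (intro kk.subspace_add[OF subspace_kk_R] kk.subspace_scale[OF subspace_kk_R])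
qed

lemma kk_R_Y_elt:
  assumes "l = 1 \<or> m2 \<ge> l - 2" "l = 1 \<or> n2 \<ge> l - 2"
  shows "Poly_Mapping.lookup (kk_Y_elt i u m1 m2 v n1 n2) e \<in> kk_R l"
proof -
  note sub = subspace_kk_R[of l]
  have *: "elt w p n2 \<in> kk_R l" for w :: "'a^'b^'b" and p
    using assms(2) by (rule elt_in_kk_R)
  have **: "kk_scale (c * of_nat (q choose m2)) (elt w n1 q) \<in> kk_R l" for w :: "'a^'b^'b" and q c
  proof (cases "q < m2")
    case True
    then show ?thesis by (simp add: binomial_eq_0 kk.subspace_0[OF subspace_kk_R])
  next
    case False
    then have "elt w n1 q \<in> kk_R l"
      using assms(1) by (intro elt_in_kk_R) auto
    then show ?thesis by (rule kk.subspace_scale[OF sub])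
  qed
  have single: "Poly_Mapping.lookup (Poly_Mapping.single e' P) e \<in> kk_R l" if "P \<in> kk_R l" for e' P
    using that by (simp add: lookup_single when_def kk.subspace_0[OF subspace_kk_R])
  show ?thesis
    unfolding kk_Y_elt_def lookup_minus lookup_sum
    by (intro kk.subspace_diff[OF sub] kk.subspace_sum[OF sub] single ** kk.subspace_scale[OF sub] *)
qed

lemma subspace_lookup:
  assumes "\<And>P Q. f (P + Q) = f P + f Q" "\<And>c P. f (kk_scale c P) = Poly_Mapping.map (kk_scale c) (f P)"
  shows "module.subspace kk_scale {P. Poly_Mapping.lookup (f P) e \<in> kk_R l}"
proof -
  note sub = subspace_kk_R[of l]
  have "f 0 = 0" by (rule additive_0) (rule assms)
  then show ?thesis
    by (intro kk.subspaceI) (auto simp: assms lookup_add lookup_map_0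
       kk.subspace_0[OF sub] kk.subspace_add[OF sub] kk.subspace_scale[OF sub])
qed

lemma kk_R_Y: 
  assumes "P \<in> kk_R l" "Q \<in> kk_R l"
  shows "Poly_Mapping.lookup (kk_Y i P Q) e \<in> kk_R l"
  using assms(1)
proof (induction rule: kk_R_induct)
  case subspace
  show ?case by (rule subspace_lookup) (auto simp: kk_Y_add_left kk_Y_scale_left)
next
  case (elt u m1 m2)
  note 1 = elt
  show ?case
    using assms(2)
  proof (induction rule: kk_R_induct)
    case subspace
    show ?case by (rule subspace_lookup) (auto simp: kk_Y_add_right kk_Y_scale_right)
  next
    case (elt v n1 n2)
    show ?case unfolding kk_Y_elt_elt by (rule kk_R_Y_elt[OF 1 elt])
  qed
qed

lemma kk_Y_negative: "e \<ge> 0 \<Longrightarrow> Poly_Mapping.lookup (kk_Y i P Q) e = 0"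
proof (induction P rule: kk_induct)
  case (elt u m1 m2)
  then show ?case
  proof (induction Q rule: kk_induct)
    case (elt v n1 n2)
    have "Poly_Mapping.lookup (Poly_Mapping.single (int p - int m1 - int m2 - int n - 1 - of_bool (i = 0)) P) e = 0"
      if "p \<le> m1 + m2 + n + of_bool (i = 0)" for p n and P :: "('a, 'b) kk"
      using that elt by (subst lookup_single_not_eq) auto
    then show ?case
      unfolding kk_Y_elt_elt kk_Y_elt_def lookup_minus lookup_sum
      by (intro iffD2[OF right_minus_eq] trans[OF sum.neutral sum.neutral[symmetric]] ballI) auto
  qed (simp add: kk_Y_add_right lookup_add)
qed (simp add: kk_Y_add_left lookup_add)

interpretation kk: conformal_data kk_scale "kk_grading l :: bit \<Rightarrow> ('a::field_char_0, 'n::finite) kk set"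
    kk_deriv "kk_Y (kk_copy l)" for l
  ..

lemma kk_total: "kk.total l = kk_R l"
  using kk.subspace_0[OF subspace_kk_R] by (auto simp: kk.total_def kk_grading_def)

lemma kk_commutator:
  assumes i: "i \<in> {0, 1 :: nat}"
  shows "kk_nprod i P m (kk_nprod i Q n T) - kk_nprod i Q n (kk_nprod i P m T)
    = (\<Sum>j\<le>m. kk_scale (of_nat (m choose j)) (kk_nprod i (kk_nprod i P (m - j) Q) (n + j) T))"
proof -
  obtain N1 where N1: "\<And>n. n \<ge> N1 \<Longrightarrow> kk_nprod i Q n T = 0"
    "\<And>m n. n \<ge> N1 \<Longrightarrow> kk_nprod i P n (kk_nprod i Q m T) = 0" using kk_nested_bound[of i Q T P] by blast
  obtain N2 where N2: "\<And>n. n \<ge> N2 \<Longrightarrow> kk_nprod i P n T = 0"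
    "\<And>m n. n \<ge> N2 \<Longrightarrow> kk_nprod i Q n (kk_nprod i P m T) = 0" using kk_nested_bound[of i P T Q] by blast
  obtain N3 where N3: "\<And>n. n \<ge> N3 \<Longrightarrow> kk_nprod i P n Q = 0"
    "\<And>m n. n \<ge> N3 \<Longrightarrow> kk_nprod i (kk_nprod i P m Q) n T = 0" using kk_nested_bound[of i P Q T] by blast
  define N where "N = N1 + N2 + N3 + m + n + 1"
  let ?l = "\<lambda>m n. kk_nprod i P m (kk_nprod i Q n T) - kk_nprod i Q n (kk_nprod i P m T)"
  let ?r = "\<lambda>m n. \<Sum>j\<le>m. kk_scale (of_nat (m choose j)) (kk_nprod i (kk_nprod i P (m - j) Q) (n + j) T)"
  let ?W = "\<lambda>m n a b. kk_eval (kk_nprod i (kk_nprod i P m Q) n T) a b"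
  have eval_diff: "kk_eval (S - U) a b = kk_eval S a b - kk_eval U a b" for S U :: "('a, 'b) kk" and a b
    by (rule additive_minus[of "\<lambda>P. kk_eval P a b"]) (rule kk_eval_add)
  have eq: "(\<Sum>m<N + N. mat_scale (x ^ m / fact m) (\<Sum>n<N + N. mat_scale (y ^ n / fact n) (kk_eval (?l m n) a b)))
    = (\<Sum>m<N + N. mat_scale (x ^ m / fact m) (\<Sum>n<N + N. mat_scale (y ^ n / fact n) (kk_eval (?r m n) a b)))"
    (is "?L = ?R") for x y a b
  proof -
    have "?L = (\<Sum>m<N + N. mat_scale (x ^ m / fact m) (\<Sum>n<N + N. mat_scale (y ^ n / fact n)
                  (kk_eval (kk_nprod i P m (kk_nprod i Q n T)) a b)))
             - (\<Sum>m<N + N. mat_scale (x ^ m / fact m) (\<Sum>n<N + N. mat_scale (y ^ n / fact n)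
                  (kk_eval (kk_nprod i Q n (kk_nprod i P m T)) a b)))"
      by (simp only: eval_diff mat_scale_algebra sum_subtractf)
    also have "(\<Sum>m<N + N. mat_scale (x ^ m / fact m) (\<Sum>n<N + N. mat_scale (y ^ n / fact n)
                  (kk_eval (kk_nprod i Q n (kk_nprod i P m T)) a b)))
        = (\<Sum>n<N + N. mat_scale (y ^ n / fact n) (\<Sum>m<N + N. mat_scale (x ^ m / fact m)
                  (kk_eval (kk_nprod i Q n (kk_nprod i P m T)) a b)))"
      unfolding mat_scale_sum by (subst sum.swap) (simp only: mat_scale_simps mult_ac)
    also have "(\<Sum>m<N + N. mat_scale (x ^ m / fact m) (\<Sum>n<N + N. mat_scale (y ^ n / fact n)
                  (kk_eval (kk_nprod i P m (kk_nprod i Q n T)) a b))) - \<dots>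
        = kk_bracket i (kk_eval P) (kk_bracket i (kk_eval Q) (kk_eval T) y) x a b
        - kk_bracket i (kk_eval Q) (kk_bracket i (kk_eval P) (kk_eval T) x) y a b"
      by (intro arg_cong2[where f = minus] kk_double_series[OF i] N1 N2) (simp_all add: N_def)
    also have "\<dots> = kk_bracket i (kk_bracket i (kk_eval P) (kk_eval Q) x) (kk_eval T) (x + y) a b"
      by (rule kk_bracket_jacobi)
    also have "\<dots> = kk_bracket i (\<lambda>a b. \<Sum>m<N. mat_scale (x ^ m / fact m) (kk_eval (kk_nprod i P m Q) a b)) (kk_eval T) (x + y) a b"
      by (subst kk_bracket_series[OF i]) (auto intro: N3 simp: N_def)
    also have "\<dots> = (\<Sum>m<N. mat_scale (x ^ m / fact m) (kk_bracket i (kk_eval (kk_nprod i P m Q)) (kk_eval T) (x + y) a b))"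
      by (simp only: kk_bracket_sum kk_bracket_linear)
    also have "\<dots> = (\<Sum>m<N. mat_scale (x ^ m / fact m) (\<Sum>n<N. mat_scale ((x + y) ^ n / fact n) (?W m n a b)))"
      by (subst kk_bracket_series[OF i]) (auto intro: N3 simp: N_def)
    also have "\<dots> = (\<Sum>r<N + N. mat_scale (x ^ r / fact r) (\<Sum>s<N + N. mat_scale (y ^ s / fact s)
            (\<Sum>j\<le>r. mat_scale (of_nat (r choose j)) (?W (r - j) (s + j) a b))))"
      by (rule commutator_reindex[symmetric]) (auto simp: N3 N_def)
    also have "\<dots> = ?R"
      by (simp only: kk_eval_sum kk_eval_scale)
    finally show ?thesis .
  qed
  have "?l m n = ?r m n"
  proof (rule kk_eval_inj)
    fix a b
    let ?d = "\<lambda>m n. kk_eval (?l m n) a b - kk_eval (?r m n) a b"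
    have "(\<Sum>m<N + N. mat_scale (x ^ m / fact m) (\<Sum>n<N + N. mat_scale (y ^ n / fact n) (?d m n))) = 0" for x y
      using eq[of x y a b] by (simp only: mat_scale_algebra sum_subtractf diff_self)
    from series_inj[where f = "\<lambda>m. \<Sum>n<N + N. mat_scale (_ ^ n / fact n) (?d m n)", OF this, of m]
    have "(\<Sum>n<N + N. mat_scale (y ^ n / fact n) (?d m n)) = 0" for y by (simp add: N_def)
    from series_inj[where f = "\<lambda>n. ?d m n", OF this, of n]
    have "?d m n = 0" by (simp add: N_def)
    then show "kk_eval (?l m n) a b = kk_eval (?r m n) a b" by simp
  qed
  then show ?thesis .
qed

lemma kk_conformal_algebra:
  "conformal_algebra kk_scale (kk_grading l :: bit \<Rightarrow> ('a::field_char_0, 'n::finite) kk set)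
     kk_deriv (kk_Y (kk_copy l))"
proof unfold_locales
  have i: "kk_copy l \<in> {0, 1}" by (simp add: kk_copy_def)
  have sub: "kk.subspace (kk_R l :: ('a, 'n) kk set)" by (rule subspace_kk_R)
  note zero = kk.subspace_0[OF sub]
  fix u v w :: "('a, 'n) kk" and j j' :: bit and c :: 'a and e :: int and m n :: nat
  show "kk.subspace (kk_grading l j :: ('a, 'n) kk set)"
    by (simp add: kk_grading_def sub kk.subspace_single_0)
  show "kk_grading l 0 \<inter> kk_grading l 1 = {0 :: ('a, 'n) kk}" using zero by (auto simp: kk_grading_def)
  show "kk_grading l 1 = {0 :: ('a, 'n) kk}" by (simp add: kk_grading_def)
  show "u \<in> kk_grading l j \<Longrightarrow> kk_deriv u \<in> kk_grading l j"
    by (auto simp: kk_grading_def kk_R_deriv split: if_splits)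
  show "kk_deriv (u + v) = kk_deriv u + kk_deriv v" by (rule kk_deriv_add)
  show "kk_deriv (kk_scale c u) = kk_scale c (kk_deriv u)" by (rule kk_deriv_scale)
  show "u \<in> kk_grading l j \<Longrightarrow> v \<in> kk_grading l j' \<Longrightarrow>
      Poly_Mapping.lookup (kk_Y (kk_copy l) u v) e \<in> kk_grading l (j + j')"
    using zero by (auto simp: kk_grading_def kk_R_Y split: if_splits)
  show "e \<ge> 0 \<Longrightarrow> Poly_Mapping.lookup (kk_Y (kk_copy l) u v) e = 0" by (rule kk_Y_negative)
  show "kk_Y (kk_copy l) (u + v) w = kk_Y (kk_copy l) u w + kk_Y (kk_copy l) v w" by (rule kk_Y_add_left)
  show "kk_Y (kk_copy l) u (v + w) = kk_Y (kk_copy l) u v + kk_Y (kk_copy l) u w" by (rule kk_Y_add_right)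
  show "kk_Y (kk_copy l) (kk_scale c u) v = Poly_Mapping.map (kk_scale c) (kk_Y (kk_copy l) u v)"
    by (rule kk_Y_scale_left)
  show "kk_Y (kk_copy l) u (kk_scale c v) = Poly_Mapping.map (kk_scale c) (kk_Y (kk_copy l) u v)"
    by (rule kk_Y_scale_right)
  show "Poly_Mapping.lookup (kk_Y (kk_copy l) (kk_deriv u) v) e
      = kk_scale (of_int (e + 1)) (Poly_Mapping.lookup (kk_Y (kk_copy l) u v) (e + 1))"
  proof (cases "e \<ge> 0")
    case True
    then show ?thesis by (simp add: kk_Y_negative)
  next
    case False
    define n where "n = nat (- e - 1)"
    have e: "e = - int n - 1" using False by (simp add: n_def)
    show ?thesis
    proof (cases n)
      case 0
      then show ?thesis using kk_derivative[OF i, of u v 0] by (simp add: e)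
    next
      case (Suc k)
      have "e + 1 = - int k - 1" "of_int (e + 1) = (- of_nat n :: 'a)" by (simp_all add: e Suc)
      then show ?thesis using kk_derivative[OF i, of u v n] by (simp only: e Suc diff_Suc_1 nat.simps if_False)
    qed
  qed
  show "kk.nprod l u n v = kk_scale (if j = 1 \<and> j' = 1 then - 1 else 1)
        (Sum_any (\<lambda>k. kk_scale ((- 1) ^ (n + k + 1) / fact k) ((kk_deriv ^^ k) (kk.nprod l v (n + k) u))))"
    if "u \<in> kk_grading l j" "v \<in> kk_grading l j'"
  proof -
    have *: "(if j = 1 \<and> j' = 1 then - 1 else 1) = (1 :: 'a) \<or> u = 0"
      using that by (auto simp: kk_grading_def)
    show ?thesis
    proof (cases "u = 0")
      case True
      then show ?thesis by (simp only: kk.nprod_def kk_nprod_0 kk_deriv_pow_0 kk.scale_zero_right Sum_any.neutral)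
    next
      case False
      with * have s: "(if j = 1 \<and> j' = 1 then - 1 else 1) = (1 :: 'a)" by blast
      show ?thesis unfolding s kk.scale_one kk.nprod_def by (rule kk_skew[OF i])
    qed
  qed
  show "kk.nprod l u m (kk.nprod l v n w)
      - kk_scale (if j = 1 \<and> j' = 1 then - 1 else 1) (kk.nprod l v n (kk.nprod l u m w))
      = (\<Sum>p\<le>m. kk_scale (of_nat (m choose p)) (kk.nprod l (kk.nprod l u (m - p) v) (n + p) w))"
    if "u \<in> kk_grading l j" "v \<in> kk_grading l j'"
  proof -
    have *: "(if j = 1 \<and> j' = 1 then - 1 else 1) = (1 :: 'a) \<or> u = 0"
      using that by (auto simp: kk_grading_def)
    show ?thesis
    proof (cases "u = 0")
      case True
      then show ?thesis
        by (simp only: kk.nprod_def kk_nprod_0 kk.scale_zero_right diff_self sum.neutral_const)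
    next
      case False
      with * have s: "(if j = 1 \<and> j' = 1 then - 1 else 1) = (1 :: 'a)" by blast
      show ?thesis unfolding s kk.scale_one kk.nprod_def by (rule kk_commutator[OF i])
    qed
  qed
qed

end

theory Submission
  imports Defs
begin

text \<open>
  \<open>u\<^sub>Nv\<close> is a difference of a term in \<open>uv\<close> that keeps the \<open>t\<^sub>2\<close>-exponent of \<open>v\<close> and a term in \<open>vu\<close> that
  keeps its \<open>t\<^sub>1\<close>-exponent.  When the \<open>t\<^sub>2\<close>-exponent of \<open>u\<close> is much larger than the exponents of \<open>v\<close>,
  the second term vanishes for all large \<open>N\<close>; when its \<open>t\<^sub>1\<close>-exponent is much larger, the first one does.

  For simplicity, multiply a nonzero \<open>h\<close> in an ideal first by elements of the former kind, choosing \<open>N\<close>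
  so that only the top power of \<open>t\<^sub>1\<close> in \<open>h\<close> contributes, then by elements of the latter kind: this
  leaves all \<open>uwv \<otimes> t\<^sub>2\<^sup>n\<close> with a fixed matrix \<open>w \<noteq> 0\<close>, hence all \<open>u \<otimes> t\<^sub>2\<^sup>n\<close>, hence everything.

  A subalgebra containing matrices times arbitrarily high powers of \<open>t\<^sub>2\<close> fills up in the same way, so
  for generation it suffices to raise the power of \<open>t\<^sub>2\<close>.  If \<open>k > 1\<close>, off-diagonal matrix units do so because
  \<open>E\<^sub>q\<^sub>qE\<^sub>p\<^sub>q = 0\<close> leaves a single term.  If \<open>k = 1\<close>, the two generators give products with the same two
  monomials, from which the one containing \<open>t\<^sub>1\<close> is eliminated.
\<close>

section \<open>Products of monomials\<close>

text \<open>For \<open>i\<close> in {0, 1} this is the closed form, from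
  \<open>coefficient_fact\<close>, of the structure constant built with \<open>gchoose\<close>;
  written with factorials it is visibly nonzero.\<close>

definition kk_coeff :: "nat \<Rightarrow> nat \<Rightarrow> nat \<Rightarrow> 'a::field_char_0" where
  "kk_coeff i n m = (- 1) ^ m * fact (n + m + of_bool (i = 0)) / (fact n * fact m)"

lemma kk_coeff_nonzero: "kk_coeff i n m \<noteq> 0"
  by (simp add: kk_coeff_def del: of_bool_eq)

lemma lookup_sum_single_shift:
  fixes f :: "nat \<Rightarrow> 'b::ab_group_add"
  shows "Poly_Mapping.lookup (\<Sum>p\<le>M. Poly_Mapping.single (int p - int M - 1) (f p)) (- int N - 1)
    = (if N \<le> M then f (M - N) else 0)"
proof -
  have "Poly_Mapping.lookup (\<Sum>p\<le>M. Poly_Mapping.single (int p - int M - 1) (f p)) (- int N - 1)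
      = (\<Sum>p\<le>M. if p = M - N \<and> N \<le> M then f p else 0)"
    unfolding lookup_sum by (intro sum.cong) (auto simp: lookup_single when_def)
  then show ?thesis by simp
qed

text \<open>For fixed \<open>N\<close> each sum contributes at most one monomial. Its binomial
  vanishes unless \<open>N \<le> m2 + n1 + d\<close>, respectively
  \<open>N \<le> m1 + n2 + d\<close>, so an \<open>N\<close> between the two bounds isolates one
  term.\<close>

lemma kk_nprod_elt:
  assumes i: "i \<in> {0, 1 :: nat}"
  defines "d \<equiv> of_bool (i = 0) :: nat"
  shows "kk_nprod i (elt u m1 m2) N (elt v n1 n2) =
     (let M = m1 + m2 + n1 + d in if N \<le> M then
        kk_scale (kk_coeff i n1 m2 * of_nat ((M - N) choose m1)) (elt (u ** v) (M - N) n2) else 0)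
   - (let M = m1 + m2 + n2 + d in if N \<le> M then
        kk_scale ((if i = 0 then - 1 else 1) * kk_coeff i n2 m1 * of_nat ((M - N) choose m2))
          (elt (v ** u) n1 (M - N)) else 0)"
proof -
  have exponent: "int p - int m1 - int m2 - int n - 1 - of_bool (i = 0)
      = int p - int (m1 + m2 + n + d) - 1" for p n
    by (simp add: d_def)
  have sign: "(of_bool (i = 1) - (of_nat n2 + 1) * of_bool (i = 0) :: 'a)
      = (if i = 0 then - 1 else 1) * (of_nat n2 * of_bool (i = 0) + 1)"
    using i by auto
  show ?thesis
    unfolding kk_Y_elt_elt kk_Y_elt_def lookup_minus exponent sign Let_def
    unfolding d_def[symmetric] lookup_sum_single_shift
    unfolding mult.assoc[of "if i = 0 then - 1 else 1 :: 'a" "of_nat n2 * of_bool (i = 0) + 1"]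
      coefficient_fact[OF i] kk_coeff_def d_def ..
qed

text \<open>At this index the first term has t1-exponent \<open>m1 + n1 - d\<close>, so its binomial
  keeps only \<open>n1 = d\<close>. The second would have t2-exponent \<open>m1 + n2 - d\<close>,
  which is below \<open>m2\<close>, and vanishes.\<close>

lemma kk_nprod_elt_top_left:
  assumes "i \<in> {0, 1 :: nat}" "n1 \<le> d" "n2 + m1 < d + m2"
  shows "kk_nprod i (elt u m1 m2) (m2 + d + of_bool (i = 0)) (elt v n1 n2)
    = (if n1 = d then kk_scale (kk_coeff i d m2) (elt (u ** v) m1 n2) else 0)"
  unfolding kk_nprod_elt[OF assms(1)] Let_def using assms(2,3)
  by (auto simp: binomial_eq_0 simp del: of_bool_eq)

text \<open>The mirror image; the sign is reversed because the surviving term is the subtracted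
  one.\<close>

lemma kk_nprod_elt_top_right:
  assumes "i \<in> {0, 1 :: nat}" "n2 \<le> e" "n1 + m2 < e + m1"
  shows "kk_nprod i (elt u m1 m2) (m1 + e + of_bool (i = 0)) (elt v n1 n2)
    = (if n2 = e then kk_scale ((if i = 0 then 1 else - 1) * kk_coeff i e m1) (elt (v ** u) n1 m2) else 0)"
  unfolding kk_nprod_elt[OF assms(1)] Let_def using assms(2,3)
  by (auto simp: binomial_eq_0 simp del: of_bool_eq)

lemma kk_as_sum: "P = (\<Sum>(m, n)\<in>Poly_Mapping.keys P. elt (Poly_Mapping.lookup P (m, n)) m n)"
  by (intro poly_mapping_eqI) (auto simp: elt_def split_def lookup_sum lookup_single when_def in_keys_iff)

lemma kk_scale_mem_iff:
  assumes "kk.subspace V" "c \<noteq> 0"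
  shows "kk_scale c P \<in> V \<longleftrightarrow> P \<in> V"
  using assms kk.subspace_scale[of V P c] kk.subspace_scale[of V "kk_scale c P" "1 / c"] by auto

section \<open>Matrix units\<close>

definition mat_unit :: "'n \<Rightarrow> 'n \<Rightarrow> 'a::field_char_0^'n^'n" where
  "mat_unit p q = (\<chi> r s. if r = p \<and> s = q then 1 else 0)"

lemma mat_unit_mult_nth: "(mat_unit p q ** A) $ x $ y = (if x = p then A $ q $ y else 0)"
proof -
  have "(mat_unit p q ** A) $ x $ y = (\<Sum>k\<in>UNIV. if k = q then (if x = p then A $ q $ y else 0) else 0)"
    unfolding matrix_matrix_mult_def vec_lambda_beta by (intro sum.cong) (auto simp: mat_unit_def)
  then show ?thesis by simp
qed

lemma mult_mat_unit_nth: "(A ** mat_unit p q) $ x $ y = (if y = q then A $ x $ p else 0)"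
proof -
  have "(A ** mat_unit p q) $ x $ y = (\<Sum>k\<in>UNIV. if k = p then (if y = q then A $ x $ p else 0) else 0)"
    unfolding matrix_matrix_mult_def vec_lambda_beta by (intro sum.cong) (auto simp: mat_unit_def)
  then show ?thesis by simp
qed

lemma mat_unit_mult: "mat_unit p q ** mat_unit r s = (if q = r then mat_unit p s else 0)"
  by (rule mat_eqI) (simp add: mat_unit_mult_nth, simp add: mat_unit_def)

text \<open>The reason why matrix algebras are simple: one nonzero entry of \<open>A\<close> yields
  every matrix unit.\<close>

lemma mat_unit_sandwich: "mat_unit p q ** A ** mat_unit r s = mat_scale (A $ q $ r) (mat_unit p s)"
  by (rule mat_eqI) (simp add: mat_unit_mult_nth mult_mat_unit_nth, simp add: mat_unit_def)

lemma mat_unit_expansion: "A = (\<Sum>p\<in>UNIV. \<Sum>q\<in>UNIV. mat_scale (A $ p $ q) (mat_unit p q))"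
proof (rule mat_eqI)
  fix r s
  have "(\<Sum>p\<in>UNIV. \<Sum>q\<in>UNIV. mat_scale (A $ p $ q) (mat_unit p q)) $ r $ s
      = (\<Sum>p\<in>UNIV. if p = r then \<Sum>q\<in>UNIV. if q = s then A $ p $ q else 0 else 0)"
    unfolding sum_component by (intro sum.cong) (auto simp: mat_unit_def if_distrib cong: if_cong)
  then show "A $ r $ s = (\<Sum>p\<in>UNIV. \<Sum>q\<in>UNIV. mat_scale (A $ p $ q) (mat_unit p q)) $ r $ s"
    by simp
qed

lemma elt_mem_if_mat_units:
  assumes V: "kk.subspace V" and "\<And>p q. elt (mat_unit p q) m n \<in> V"
  shows "elt A m n \<in> V"
proof -
  have "elt A m n = (\<Sum>p\<in>UNIV. \<Sum>q\<in>UNIV. kk_scale (A $ p $ q) (elt (mat_unit p q) m n))"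
    by (subst mat_unit_expansion) (simp add: additive_sum[of "\<lambda>u. elt u m n", OF elt_add] kk_scale_elt)
  then show ?thesis
    using assms by (simp add: kk.subspace_sum kk.subspace_scale)
qed

lemma kk_R_subset:
  fixes V :: "('a::field_char_0, 'n::finite) kk set"
  assumes V: "kk.subspace V" and "\<And>u m n. l = 1 \<or> n \<ge> l - 2 \<Longrightarrow> elt u m n \<in> V"
  shows "kk_R l \<subseteq> V"
proof
  fix P :: "('a, 'n) kk" assume "P \<in> kk_R l"
  then show "P \<in> V" by (induction rule: kk_R_induct) (use assms in auto)
qed

lemma kk_copy_cases: "kk_copy l \<in> {0, 1}"
  by (simp add: kk_copy_def)

section \<open>Simplicity\<close>

lemma kk_ideal_nprod:
  assumes "kk.ideal l I" "l = 1 \<or> m2 \<ge> l - 2" "P \<in> I"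
  shows "kk_nprod (kk_copy l) (elt u m1 m2) N P \<in> I"
  using assms by (auto simp: kk.ideal_def kk_total elt_in_kk_R)

text \<open>One product isolates the part of \<open>h\<close> of t1-degree \<open>d\<close>: the
  surviving monomials all carry the same scalar \<open>kk_coeff i d m2\<close>, which can be divided
  out.\<close>

lemma kk_ideal_leading_left:
  assumes I: "kk.ideal l I" and h: "h \<in> I" and d: "\<And>m n. (m, n) \<in> Poly_Mapping.keys h \<Longrightarrow> m \<le> d"
  shows "(\<Sum>(m, n)\<in>{x \<in> Poly_Mapping.keys h. fst x = d}. elt (u ** Poly_Mapping.lookup h (m, n)) m1 n) \<in> I"
proof -
  let ?K = "Poly_Mapping.keys h" and ?i = "kk_copy l"
  define e where "e = Max (snd ` ?K)"
  have e: "n \<le> e" if "(m, n) \<in> ?K" for m n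
    unfolding e_def using that by (intro Max_ge) force+
  \<comment> \<open>The summand \<open>l\<close> puts the multiplier into \<open>kk_R l\<close>; the
    rest makes \<open>m2\<close> exceed every \<open>n + m1\<close>, which removes the second
    terms.\<close>
  define m2 where "m2 = l + m1 + e + 1"
  have "kk_nprod ?i (elt u m1 m2) (m2 + d + of_bool (?i = 0)) h
     = (\<Sum>x\<in>?K. kk_nprod ?i (elt u m1 m2) (m2 + d + of_bool (?i = 0))
            (elt (Poly_Mapping.lookup h (fst x, snd x)) (fst x) (snd x)))"
    by (subst (1) kk_as_sum[of h]) (simp only: kk_nprod_sum split_def)
  also have "\<dots> = (\<Sum>x\<in>?K. if fst x = d then
        kk_scale (kk_coeff ?i d m2) (elt (u ** Poly_Mapping.lookup h (fst x, snd x)) m1 (snd x)) else 0)"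
  proof (rule sum.cong[OF refl])
    fix x assume "x \<in> ?K"
    then have "fst x \<le> d" "snd x + m1 < d + m2"
      using d[of "fst x" "snd x"] e[of "fst x" "snd x"] by (auto simp: m2_def)
    from kk_nprod_elt_top_left[OF kk_copy_cases this]
    show "kk_nprod ?i (elt u m1 m2) (m2 + d + of_bool (?i = 0))
            (elt (Poly_Mapping.lookup h (fst x, snd x)) (fst x) (snd x))
      = (if fst x = d then
        kk_scale (kk_coeff ?i d m2) (elt (u ** Poly_Mapping.lookup h (fst x, snd x)) m1 (snd x)) else 0)" .
  qed
  also have "\<dots> = kk_scale (kk_coeff ?i d m2)
      (\<Sum>x\<in>{x \<in> ?K. fst x = d}. elt (u ** Poly_Mapping.lookup h (fst x, snd x)) m1 (snd x))"
    unfolding kk.scale_sum_right by (rule sum.inter_filter[symmetric]) simp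
  finally have eq: "kk_nprod ?i (elt u m1 m2) (m2 + d + of_bool (?i = 0)) h = \<dots>" .
  have "\<dots> \<in> I" unfolding eq[symmetric] by (rule kk_ideal_nprod[OF I _ h]) (auto simp: m2_def)
  then show ?thesis
    using I unfolding kk.ideal_def split_def by (simp only: kk_scale_mem_iff[OF _ kk_coeff_nonzero])
qed

lemma kk_ideal_leading_right:
  fixes I :: "('a::field_char_0, 'n::finite) kk set" and f :: "nat \<Rightarrow> 'a^'n^'n"
  assumes I: "kk.ideal l I" and f: "(\<Sum>n\<in>A. elt (f n) 0 n) \<in> I" and A: "finite A"
    and e: "e \<in> A" "\<And>n. n \<in> A \<Longrightarrow> n \<le> e" and m2: "l = 1 \<or> m2 \<ge> l - 2"
  shows "elt (f e ** u) 0 m2 \<in> I"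
proof -
  let ?i = "kk_copy l"
  \<comment> \<open>All t1-exponents in the sum are 0, so \<open>m1 > m2\<close> already removes the
    first terms.\<close>
  define m1 where "m1 = m2 + 1"
  define c :: 'a where "c = (if ?i = 0 then 1 else - 1) * kk_coeff ?i e m1"
  have "kk_nprod ?i (elt u m1 m2) (m1 + e + of_bool (?i = 0)) (\<Sum>n\<in>A. elt (f n) 0 n)
     = (\<Sum>n\<in>A. if n = e then kk_scale c (elt (f n ** u) 0 m2) else 0)"
    unfolding kk_nprod_sum c_def using e(2)
    by (intro sum.cong kk_nprod_elt_top_right kk_copy_cases) (auto simp: m1_def)
  also have "\<dots> = kk_scale c (elt (f e ** u) 0 m2)"
    using A e(1) by simp
  finally have eq: "kk_nprod ?i (elt u m1 m2) (m1 + e + of_bool (?i = 0)) (\<Sum>n\<in>A. elt (f n) 0 n) = \<dots>" .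
  have "\<dots> \<in> I" unfolding eq[symmetric] by (rule kk_ideal_nprod[OF I m2 f])
  then show ?thesis
    using I by (simp add: kk.ideal_def kk_scale_mem_iff kk_coeff_nonzero c_def)
qed

lemma kk_simple:
  "conformal_data.simple kk_scale (kk_grading l :: bit \<Rightarrow> ('a::field_char_0, 'n::finite) kk set)
     kk_deriv (kk_Y (kk_copy l))"
  unfolding kk.simple_def kk_total
proof (intro allI impI)
  fix I :: "('a, 'n) kk set"
  assume I: "kk.ideal l I"
  then have sub: "kk.subspace I" and IR: "I \<subseteq> kk_R l" by (auto simp: kk.ideal_def kk_total)
  show "I = {0} \<or> I = kk_R l"
  proof (cases "I = {0}")
    case False
    then obtain h where h: "h \<in> I" "h \<noteq> 0" using kk.subspace_0[OF sub] by blast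
    let ?K = "Poly_Mapping.keys h"
    define d where "d = Max (fst ` ?K)"
    have K: "finite ?K" "?K \<noteq> {}" using h by simp_all
    have d: "m \<le> d" if "(m, n) \<in> ?K" for m n
      unfolding d_def using that by (intro Max_ge) force+
    define A where "A = {n. (d, n) \<in> ?K}"
    have KA: "{x \<in> ?K. fst x = d} = Pair d ` A" by (auto simp: A_def)
    have "finite (Pair d ` A)" using K by (simp flip: KA)
    then have A: "finite A" by (rule finite_imageD) (simp add: inj_on_def)
    have "d \<in> fst ` ?K" unfolding d_def using K by (intro Max_in) auto
    then have "A \<noteq> {}" by (auto simp: A_def)
    define e where "e = Max A"
    have e: "e \<in> A" "\<And>n. n \<in> A \<Longrightarrow> n \<le> e"
      unfolding e_def using A \<open>A \<noteq> {}\<close> by auto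
    \<comment> \<open>The leading coefficient of \<open>h\<close>: highest power of t1 first, then
      highest power of t2.\<close>
    define w where "w = Poly_Mapping.lookup h (d, e)"
    have "w \<noteq> 0" using e(1) by (simp add: A_def w_def in_keys_iff)
    then obtain r s where rs: "w $ r $ s \<noteq> 0" by (auto simp: vec_eq_iff)
    have "(\<Sum>n\<in>A. elt (u ** Poly_Mapping.lookup h (d, n)) 0 n) \<in> I" for u :: "'a^'n^'n"
      using kk_ideal_leading_left[where u = u and ?m1.0 = 0, OF I h(1) d]
      unfolding KA by (subst (asm) sum.reindex) (auto simp: inj_on_def)
    then have uwv: "elt (u ** w ** v) 0 n \<in> I" if "l = 1 \<or> n \<ge> l - 2" for u v n
      unfolding w_def by (rule kk_ideal_leading_right[OF I _ A e that])
    have "elt (mat_unit p q) 0 n \<in> I" if "l = 1 \<or> n \<ge> l - 2" for p q n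
      using uwv[OF that, of "mat_unit p r" "mat_unit s q"]
      unfolding mat_unit_sandwich kk_scale_elt[symmetric] by (simp only: kk_scale_mem_iff[OF sub rs])
    then have *: "elt u 0 n \<in> I" if "l = 1 \<or> n \<ge> l - 2" for u n
      by (rule elt_mem_if_mat_units[OF sub]) (use that in blast)
    \<comment> \<open>The t1-exponent is raised from 0 to \<open>m\<close> by isolating the part of
      t1-degree 0 of \<open>elt u 0 n\<close> with multiplier \<open>mat 1\<close>. The zero matrix
      is split off because its monomial has no keys.\<close>
    have "elt u m n \<in> I" if "l = 1 \<or> n \<ge> l - 2" for u m n
    proof (cases "u = 0")
      case True
      then show ?thesis by (simp add: kk.subspace_0[OF sub])
    next
      case False
      then have keys: "{x \<in> Poly_Mapping.keys (elt u 0 n :: ('a, 'n) kk). fst x = 0} = {(0, n)}"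
        and lookup: "Poly_Mapping.lookup (elt u 0 n) (0, n) = u"
        by (auto simp: elt_def)
      have "(\<Sum>(m', n')\<in>{(0, n)}. elt (mat 1 ** Poly_Mapping.lookup (elt u 0 n) (m', n')) m n') \<in> I"
        unfolding keys[symmetric]
        by (rule kk_ideal_leading_left[OF I *[OF that]]) (auto simp: elt_def split: if_splits)
      then show ?thesis by (simp add: lookup)
    qed
    then have "kk_R l \<subseteq> I" by (intro kk_R_subset[OF sub])
    then show ?thesis using IR by blast
  qed simp
qed

section \<open>Generators\<close>

definition kk_closed :: "nat \<Rightarrow> ('a::field_char_0, 'n::finite) kk set \<Rightarrow> bool" where
  "kk_closed i V \<longleftrightarrow> kk.subspace V \<and> (\<forall>P\<in>V. \<forall>Q\<in>V. \<forall>n. kk_nprod i P n Q \<in> V)"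

lemma kk_closed_subspace: "kk_closed i V \<Longrightarrow> kk.subspace V"
  and kk_closed_nprod: "kk_closed i V \<Longrightarrow> P \<in> V \<Longrightarrow> Q \<in> V \<Longrightarrow> kk_nprod i P n Q \<in> V"
  by (auto simp: kk_closed_def)

text \<open>Solving the commutator formula for its term \<open>p = 0\<close> expresses left multiplication by
  \<open>u\<^sub>m v\<close> through left multiplications by \<open>u\<close>, \<open>v\<close> and \<open>u\<^sub>j v\<close> with \<open>j < m\<close>.\<close>

lemma kk_nprod_nprod_left:
  assumes i: "i \<in> {0, 1 :: nat}" and V: "kk.subspace V" and T: "T \<in> V"
    and P: "\<And>n T. T \<in> V \<Longrightarrow> kk_nprod i P n T \<in> V" and Q: "\<And>n T. T \<in> V \<Longrightarrow> kk_nprod i Q n T \<in> V"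
  shows "kk_nprod i (kk_nprod i P m Q) n T \<in> V"
  using T
proof (induction m arbitrary: n T rule: less_induct)
  case (less m)
  let ?f = "\<lambda>j. kk_scale (of_nat (m choose j)) (kk_nprod i (kk_nprod i P (m - j) Q) (n + j) T)"
  have "kk_nprod i P m (kk_nprod i Q n T) - kk_nprod i Q n (kk_nprod i P m T) = ?f 0 + (\<Sum>j\<in>{..m} - {0}. ?f j)"
    unfolding kk_commutator[OF i] by (rule sum.remove) auto
  then have "kk_nprod i (kk_nprod i P m Q) n T = kk_nprod i P m (kk_nprod i Q n T)
      - kk_nprod i Q n (kk_nprod i P m T) - (\<Sum>j\<in>{..m} - {0}. ?f j)"
    by (simp add: algebra_simps)
  also have "\<dots> \<in> V"
  proof (intro kk.subspace_diff[OF V] kk.subspace_sum[OF V] kk.subspace_scale[OF V])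
    show "kk_nprod i P m (kk_nprod i Q n T) \<in> V" "kk_nprod i Q n (kk_nprod i P m T) \<in> V"
      using less.prems by (simp_all only: P Q)
    show "kk_nprod i (kk_nprod i P (m - j) Q) (n + j) T \<in> V" if "j \<in> {..m} - {0}" for j
      using that by (intro less.IH less.prems) auto
  qed
  finally show ?case .
qed

text \<open>The span of the right-nested words is itself closed under all products, so it is one of
  the sets \<open>V\<close> to which \<open>closed\<close> applies.\<close>

lemma kk_generated_byI:
  fixes S :: "('a::field_char_0, 'n::finite) kk set"
  assumes S: "S \<subseteq> kk_R l" and closed: "\<And>V. kk_closed (kk_copy l) V \<Longrightarrow> S \<subseteq> V \<Longrightarrow> kk_R l \<subseteq> V"
  shows "conformal_data.generated_by kk_scale (kk_grading l) (kk_Y (kk_copy l)) S"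
proof -
  let ?i = "kk_copy l"
  let ?word = "\<lambda>us v. foldr (\<lambda>(u, m) w. kk_nprod ?i u m w) us v"
  define W where "W = {?word us v | us v. fst ` set us \<subseteq> S \<and> v \<in> S}"
  define V where "V = kk.span W"
  have V: "kk.subspace V" by (simp add: V_def)
  \<comment> \<open>Closedness of \<open>V\<close> means \<open>V \<subseteq> L\<close>. Generators
    lie in \<open>L\<close> because they only prefix a letter; words follow by induction from the
    commutator formula.\<close>
  define L where "L = {P. \<forall>n. \<forall>T\<in>V. kk_nprod ?i P n T \<in> V}"
  have L: "kk.subspace L"
    by (rule kk.subspaceI) (auto simp: L_def kk_nprod_add kk_nprod_scale
        intro: kk.subspace_0[OF V] kk.subspace_add[OF V] kk.subspace_scale[OF V])
  have SL: "S \<subseteq> L"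
  proof
    fix u assume u: "u \<in> S"
    have "kk_nprod ?i u n T \<in> V" if "T \<in> V" for n T
      using that unfolding V_def
    proof (induction rule: kk.span_induct)
      case base
      show ?case
        by (rule kk.subspaceI) (auto simp: kk_nprod_add kk_nprod_scale kk.span_zero kk.span_add kk.span_scale)
    next
      case (step T)
      then obtain us v where T: "T = ?word us v" "fst ` set us \<subseteq> S" "v \<in> S" by (auto simp: W_def)
      then have "kk_nprod ?i u n T = ?word ((u, n) # us) v" "fst ` set ((u, n) # us) \<subseteq> S"
        using u by auto
      then show ?case using T(3) unfolding W_def by (intro kk.span_base) blast
    qed
    then show "u \<in> L" by (simp add: L_def)
  qed
  have word_L: "?word us v \<in> L" if "fst ` set us \<subseteq> S" "v \<in> S" for us v
    using that
  proof (induction us)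
    case (Cons a us)
    then have "fst a \<in> L" "?word us v \<in> L" using SL by auto
    then have "kk_nprod ?i (fst a) (snd a) (?word us v) \<in> L"
      by (auto simp: L_def intro!: kk_nprod_nprod_left[OF kk_copy_cases V])
    then show ?case by (simp add: split_def)
  qed (use SL in auto)
  have "V \<subseteq> L"
    unfolding V_def by (rule kk.span_minimal[OF _ L]) (auto simp: W_def intro: word_L)
  then have "kk_closed ?i V" using V by (auto simp: kk_closed_def L_def)
  moreover have "S \<subseteq> V"
  proof
    fix v assume "v \<in> S"
    then have "\<exists>us v'. v = ?word us v' \<and> fst ` set us \<subseteq> S \<and> v' \<in> S"
      by (intro exI[of _ "[]"] exI[of _ v]) simp
    then show "v \<in> V" unfolding V_def W_def by (intro kk.span_base CollectI)
  qed
  ultimately have "kk_R l \<subseteq> V" by (rule closed)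
  moreover have "?word us v \<in> kk_R l" if "fst ` set us \<subseteq> S" "v \<in> S" for us v
    using that by (induction us) (use S in \<open>auto intro: kk_R_Y\<close>)
  then have "V \<subseteq> kk_R l"
    unfolding V_def by (intro kk.span_minimal[OF _ subspace_kk_R]) (auto simp: W_def)
  ultimately show ?thesis
    unfolding kk.generated_by_def kk_total kk.nprod_def V_def W_def by simp
qed

section \<open>Isolating one term of a product inside a subalgebra\<close>

lemma kk_closed_factor_left:
  assumes i: "i \<in> {0, 1 :: nat}" and V: "kk_closed i V"
    and mem: "elt u m1 m2 \<in> V" "elt v n1 n2 \<in> V" and p: "m1 \<le> p" "p + n2 < n1 + m2"
  shows "elt (u ** v) p n2 \<in> V"
proof -
  \<comment> \<open>This index gives the first term t1-exponent \<open>p\<close>; the second would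
    have t2-exponent \<open>p + n2 - n1\<close>, which is below \<open>m2\<close>, so it
    vanishes.\<close>
  let ?N = "m1 + m2 + n1 + of_bool (i = 0) - p"
  have "kk_nprod i (elt u m1 m2) ?N (elt v n1 n2)
      = kk_scale (kk_coeff i n1 m2 * of_nat (p choose m1)) (elt (u ** v) p n2)"
    unfolding kk_nprod_elt[OF i] Let_def using p
    by (auto simp: binomial_eq_0 simp del: of_bool_eq)
  moreover have "kk_coeff i n1 m2 * of_nat (p choose m1) \<noteq> (0 :: 'a)"
    using p by (simp add: kk_coeff_nonzero)
  ultimately show ?thesis
    using kk_closed_nprod[OF V mem, of ?N] by (simp only: kk_scale_mem_iff[OF kk_closed_subspace[OF V]] not_False_eq_True)
qed

text \<open>The unwanted term dies either by its exponent or because \<open>u ** v = 0\<close>. In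
  the latter case nothing else bounds \<open>q\<close>, so the range of the truncated subtraction in
  \<open>?N\<close> is a hypothesis.\<close>

lemma kk_closed_factor_right:
  assumes i: "i \<in> {0, 1 :: nat}" and V: "kk_closed i V"
    and mem: "elt u m1 m2 \<in> V" "elt v n1 n2 \<in> V" and q: "m2 \<le> q" "q \<le> m1 + m2 + n2 + of_bool (i = 0)"
    and "u ** v = 0 \<or> q + n1 < n2 + m1"
  shows "elt (v ** u) n1 q \<in> V"
proof -
  let ?N = "m1 + m2 + n2 + of_bool (i = 0) - q"
  define c :: 'a where "c = (if i = 0 then 1 else - 1) * kk_coeff i n2 m1 * of_nat (q choose m2)"
  have "kk_nprod i (elt u m1 m2) ?N (elt v n1 n2) = kk_scale c (elt (v ** u) n1 q)"
    unfolding kk_nprod_elt[OF i] Let_def c_def using q assms(7)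
    by (auto simp: binomial_eq_0 simp del: of_bool_eq)
  moreover have "c \<noteq> 0"
    using q by (simp add: kk_coeff_nonzero c_def)
  ultimately show ?thesis
    using kk_closed_nprod[OF V mem, of ?N] by (simp only: kk_scale_mem_iff[OF kk_closed_subspace[OF V]] not_False_eq_True)
qed

text \<open>High powers of t2 produce every power of t1 at the lowest t2-exponent \<open>c\<close>;
  high powers of t1 then produce every t2-exponent from \<open>c\<close> on.\<close>

lemma kk_closed_full_identity:
  fixes V :: "('a::field_char_0, 'n::finite) kk set"
  assumes i: "i \<in> {0, 1 :: nat}" and V: "kk_closed i V"
    and unbounded: "\<And>B. \<exists>M\<ge>B. elt (mat 1) 0 M \<in> V" and m0: "elt (mat 1) m0 c \<in> V" and n: "c \<le> n"
  shows "elt (mat 1) m n \<in> V"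
proof -
  have row: "elt (mat 1) p c \<in> V" for p
  proof -
    obtain M where M: "M \<ge> p + c + 1" "elt (mat 1) 0 M \<in> V" using unbounded by blast
    then show ?thesis
      using kk_closed_factor_left[OF i V M(2) m0, of p] by simp
  qed
  show ?thesis
    using kk_closed_factor_right[OF i V row[of "n + m + 1"] row[of m], of n] n by simp
qed

lemma kk_closed_full_matrix:
  fixes V :: "('a::field_char_0, 'n::finite) kk set"
  assumes i: "i \<in> {0, 1 :: nat}" and V: "kk_closed i V" and card: "CARD('n) > 1"
    and e: "\<And>u. elt u 0 e \<in> V" "c \<le> e"
    and f: "\<And>u. elt u f c \<in> V" "f + of_bool (i = 0) \<ge> 1"
    and n: "c \<le> n"
  shows "elt u m n \<in> V"
proof -
  \<comment> \<open>Left multiplication by \<open>mat_unit q q\<close> at \<open>(f, c)\<close>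
    raises the t2-exponent by one. Here \<open>f\<close> may be too small for the exponent
    criterion, so the vanishing product is used; the bound on \<open>f\<close> leaves room for the
    step.\<close>
  have column: "elt (mat_unit p q) 0 (e + r) \<in> V" if "p \<noteq> q" for p q r
  proof (induction r)
    case (Suc r)
    show ?case
      using kk_closed_factor_right[OF i V f(1)[of "mat_unit q q"] Suc, of "e + Suc r"] that e(2) f(2)
      by (simp add: mat_unit_mult)
  qed (simp add: e)
  \<comment> \<open>A second index \<open>q\<close> exists since the matrix size exceeds 1, and the
    product of the units \<open>p q\<close> and \<open>q p\<close> is diagonal.\<close>
  have diag_row: "elt (mat_unit p p) r c \<in> V" for p r
  proof -
    obtain q where q: "p \<noteq> q"
    proof -
      have "\<not> (UNIV :: 'n set) \<subseteq> {p}"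
        using card card_mono[of "{p}" "UNIV :: 'n set"] by auto
      then show thesis by (auto intro: that)
    qed
    show ?thesis
      using kk_closed_factor_left[OF i V column[OF q, of "r + c + 1"] f(1)[of "mat_unit q p"], of r]
      by (simp add: mat_unit_mult)
  qed
  have diag: "elt (mat_unit p p) m n \<in> V" if "c \<le> n" for p m n
    using kk_closed_factor_right[OF i V diag_row[of p "n + m + 1"] diag_row[of p m], of n] that
    by (simp add: mat_unit_mult)
  have row: "elt (mat_unit p q) r c \<in> V" for p q r
    using kk_closed_factor_left[OF i V diag[of "r + c + 1" p 0] f(1)[of "mat_unit p q"], of r]
    by (simp add: mat_unit_mult)
  have "elt (mat_unit p q) m n \<in> V" for p q
    using kk_closed_factor_right[OF i V diag_row[of q "n + m + 1"] row[of p q m], of n] n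
    by (simp add: mat_unit_mult)
  then show ?thesis by (rule elt_mem_if_mat_units[OF kk_closed_subspace[OF V]])
qed

section \<open>Raising the power of t2 with identity coefficients\<close>

lemma mem_if_independent_combinations:
  assumes V: "kk.subspace V"
    and "kk_scale a P + kk_scale b Q \<in> V" "kk_scale a' P + kk_scale b' Q \<in> V" and det: "a * b' \<noteq> a' * b"
  shows "Q \<in> V"
proof -
  have "kk_scale (a * b' - a' * b) Q
      = kk_scale a (kk_scale a' P + kk_scale b' Q) - kk_scale a' (kk_scale a P + kk_scale b Q)"
    by (simp add: kk.scale_right_distrib kk.scale_left_diff_distrib mult.commute)
  also have "\<dots> \<in> V"
    using assms(2,3) by (intro kk.subspace_diff[OF V] kk.subspace_scale[OF V])
  finally show ?thesis
    using det by (simp add: kk_scale_mem_iff[OF V])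
qed

lemma kk_copy_0_raise:
  fixes V :: "('a::field_char_0, 'n::finite) kk set"
  assumes V: "kk_closed 0 V"
    and mem: "elt (mat 1) 0 c \<in> V" "elt (mat 1) 0 (c + 1) \<in> V" "elt (mat 1) 0 r \<in> V"
  shows "elt (mat 1) 0 (c + r + 1) \<in> V"
proof (rule mem_if_independent_combinations[OF kk_closed_subspace[OF V]])
  let ?e = "elt (mat 1) :: nat \<Rightarrow> nat \<Rightarrow> ('a, 'n) kk"
  let ?b = "of_nat ((r + 1) * ((c + r + 1) choose c)) :: 'a"
    and ?b' = "of_nat ((r + 1) * ((c + r + 1) choose (c + 1))) :: 'a"
  have coeff: "kk_coeff 0 0 m = (- 1) ^ m * of_nat (m + 1)" "kk_coeff 0 m 0 = (of_nat (m + 1) :: 'a)" for m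
    by (simp_all add: kk_coeff_def)
  \<comment> \<open>The indices 0 here and 1 below are chosen so that both products involve the same
    two monomials.\<close>
  have "kk_nprod 0 (?e 0 c) 0 (?e 0 r)
      = kk_scale ((- 1) ^ c * of_nat (c + 1)) (?e (c + 1) r) + kk_scale ?b (?e 0 (c + r + 1))"
    by (subst kk_nprod_elt) (simp_all add: coeff algebra_simps)
  then show "kk_scale ((- 1) ^ c * of_nat (c + 1)) (?e (c + 1) r) + kk_scale ?b (?e 0 (c + r + 1)) \<in> V"
    using kk_closed_nprod[OF V mem(1,3), of 0] by simp
  have "kk_nprod 0 (?e 0 (c + 1)) 1 (?e 0 r)
      = kk_scale ((- 1) ^ (c + 1) * of_nat (c + 2)) (?e (c + 1) r) + kk_scale ?b' (?e 0 (c + r + 1))"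
    by (subst kk_nprod_elt) (simp_all add: coeff algebra_simps)
  then show "kk_scale ((- 1) ^ (c + 1) * of_nat (c + 2)) (?e (c + 1) r) + kk_scale ?b' (?e 0 (c + r + 1)) \<in> V"
    using kk_closed_nprod[OF V mem(2,3), of 1] by simp
  \<comment> \<open>The coefficients of the first monomial have opposite signs and those of the
    second are positive, so the determinant is, up to sign, a positive integer.\<close>
  have "of_nat (c + 1) * ?b' + of_nat (c + 2) * ?b \<noteq> 0"
    unfolding of_nat_mult[symmetric] of_nat_add[symmetric] of_nat_eq_0_iff by simp
  moreover have "(- 1) ^ c * of_nat (c + 1) * ?b' - (- 1) ^ (c + 1) * of_nat (c + 2) * ?b
      = (- 1) ^ c * (of_nat (c + 1) * ?b' + of_nat (c + 2) * ?b)"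
    by (simp only: power_add power_one_right algebra_simps) simp
  ultimately show "(- 1) ^ c * of_nat (c + 1) * ?b' \<noteq> (- 1) ^ (c + 1) * of_nat (c + 2) * ?b"
    by (metis mult_eq_0_iff power_not_zero right_minus_eq zero_neq_neg_one)
qed

lemma kk_copy_1_raise:
  fixes V :: "('a::field_char_0, 'n::finite) kk set"
  assumes V: "kk_closed 1 V"
    and mem: "elt (mat 1) 1 0 \<in> V" "elt (mat 1) 0 2 \<in> V" "elt (mat 1) 0 r \<in> V"
  shows "elt (mat 1) 0 (r + 1) \<in> V"
proof (rule mem_if_independent_combinations[OF kk_closed_subspace[OF V]])
  let ?e = "elt (mat 1) :: nat \<Rightarrow> nat \<Rightarrow> ('a, 'n) kk"
  let ?b = "of_nat (r + 1) :: 'a" and ?b' = "- of_nat ((r + 1) choose 2) :: 'a"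
  have coeff: "kk_coeff 1 0 m = ((- 1) ^ m :: 'a)" "kk_coeff 1 m 0 = (1 :: 'a)"
    "kk_coeff 1 m 1 = (- of_nat (m + 1) :: 'a)" for m
    by (simp_all add: kk_coeff_def)
  have "kk_nprod 1 (?e 1 0) 0 (?e 0 r) = kk_scale 1 (?e 1 r) + kk_scale ?b (?e 0 (r + 1))"
    by (subst kk_nprod_elt) (simp_all add: coeff[simplified] algebra_simps)
  then show "kk_scale 1 (?e 1 r) + kk_scale ?b (?e 0 (r + 1)) \<in> V"
    using kk_closed_nprod[OF V mem(1,3), of 0] by simp
  have "kk_nprod 1 (?e 0 2) 1 (?e 0 r) = kk_scale 1 (?e 1 r) + kk_scale ?b' (?e 0 (r + 1))"
    by (subst kk_nprod_elt) (simp_all add: coeff[simplified] algebra_simps)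
  then show "kk_scale 1 (?e 1 r) + kk_scale ?b' (?e 0 (r + 1)) \<in> V"
    using kk_closed_nprod[OF V mem(2,3), of 1] by simp
  \<comment> \<open>The difference \<open>?b - ?b'\<close> is a positive integer, hence nonzero in
    characteristic 0.\<close>
  have "of_nat (((r + 1) choose 2) + (r + 1)) \<noteq> (0 :: 'a)"
    unfolding of_nat_eq_0_iff by simp
  then show "1 * ?b' \<noteq> 1 * ?b"
    by (metis add.commute eq_neg_iff_add_eq_0 mult_1 of_nat_add)
qed

text \<open>The truncated \<open>l - 2\<close> is the least t2-exponent in both copies, being 0 for
  \<open>l = 1\<close>.\<close>

lemma kk_generated_if_card_gt_1:
  fixes S :: "('a::field_char_0, 'n::finite) kk set"
  assumes card: "CARD('n) > 1" and S: "S \<subseteq> kk_R l"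
    and e: "\<And>u. elt u 0 e \<in> S" "l - 2 \<le> e"
    and f: "\<And>u. elt u f (l - 2) \<in> S" "f + of_bool (kk_copy l = 0) \<ge> 1"
  shows "conformal_data.generated_by kk_scale (kk_grading l) (kk_Y (kk_copy l)) S"
proof (rule kk_generated_byI[OF S])
  fix V assume V: "kk_closed (kk_copy l) V" and "S \<subseteq> V"
  then have "elt u 0 e \<in> V" "elt u f (l - 2) \<in> V" for u using e f by auto
  then have "elt u m n \<in> V" if "n \<ge> l - 2" for u m n
    using kk_closed_full_matrix[OF kk_copy_cases V card _ e(2) _ f(2) that] by blast
  then show "kk_R l \<subseteq> V" by (intro kk_R_subset kk_closed_subspace[OF V]) auto
qed

lemma kk_generated_if_card_eq_1:
  fixes S :: "('a::field_char_0, 'n::finite) kk set"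
  assumes card: "CARD('n) = 1" and S: "S \<subseteq> kk_R l"
    and m0: "elt (mat 1) m0 (l - 2) \<in> S" and start: "elt (mat 1) 0 e \<in> S"
    and raise: "\<And>V r. kk_closed (kk_copy l) V \<Longrightarrow> S \<subseteq> V \<Longrightarrow> elt (mat 1) 0 r \<in> V
      \<Longrightarrow> \<exists>r'>r. elt (mat 1) 0 r' \<in> V"
  shows "conformal_data.generated_by kk_scale (kk_grading l) (kk_Y (kk_copy l)) S"
proof (rule kk_generated_byI[OF S])
  fix V assume V: "kk_closed (kk_copy l) V" and SV: "S \<subseteq> V"
  note sub = kk_closed_subspace[OF V]
  have unbounded: "\<exists>M\<ge>B. elt (mat 1) 0 M \<in> V" for B
  proof (induction B)
    case 0
    show ?case using start SV by blast
  next
    case (Suc B)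
    then show ?case using raise[OF V SV] by (meson Suc_leI le_less_trans)
  qed
  \<comment> \<open>With a single index the identity is the only matrix unit, so identity
    coefficients suffice.\<close>
  have "mat_unit p q = (mat 1 :: 'a^'n^'n)" for p q
  proof -
    have "x = y" for x y :: 'n
      using card by (metis UNIV_I card_1_singletonE singletonD)
    then show ?thesis by (intro mat_eqI) (auto simp: mat_unit_def mat_def)
  qed
  then have "elt u m n \<in> V" if "n \<ge> l - 2" for u m n
    using kk_closed_full_identity[OF kk_copy_cases V unbounded _ that] m0 SV
    by - (rule elt_mem_if_mat_units[OF sub], auto)
  then show "kk_R l \<subseteq> V" by (intro kk_R_subset[OF sub]) auto
qed

section \<open>The generating weight spaces\<close>

lemma kk_weight_space_lowest:
  assumes "l \<ge> 2"
  shows "(kk_weight_space l l :: ('a::field_char_0, 'n::finite) kk set) = {elt u 0 (l - 2) | u. True}"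
proof -
  let ?W = "range (\<lambda>u. elt u 0 (l - 2)) :: ('a, 'n) kk set"
  have index: "n \<ge> l - 2 \<and> m + n + 2 = l \<longleftrightarrow> m = 0 \<and> n = l - 2" for m n using assms by auto
  have eq: "{elt u m n | u m n. n \<ge> l - 2 \<and> m + n + 2 = l} = ?W"
    unfolding index by auto
  \<comment> \<open>Monomials with one fixed exponent pair already form a subspace, so taking the
    span adds nothing.\<close>
  have "kk.subspace ?W"
  proof (rule kk.subspaceI)
    show "0 \<in> ?W" by (rule range_eqI[of _ _ 0]) simp
    show "P + Q \<in> ?W" if "P \<in> ?W" "Q \<in> ?W" for P Q using that by (auto simp flip: elt_add)
    show "kk_scale c P \<in> ?W" if "P \<in> ?W" for c P using that by (auto simp: kk_scale_elt)
  qed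
  then have "kk.span ?W = ?W" by (simp only: kk.span_eq_iff)
  moreover have "?W = {elt u 0 (l - 2) | u. True}" by auto
  moreover have "kk_weight_space l l = kk.span ?W"
    using assms unfolding kk_weight_space_def eq by simp
  ultimately show ?thesis by simp
qed

lemma kk_weight_space_1_2:
  "(kk_weight_space 1 2 :: ('a::field_char_0, 'n::finite) kk set)
     = module.span kk_scale ({elt u 1 0 | u. True} \<union> {elt u 0 1 | u. True})"
proof -
  have index: "m + n + 1 = 2 \<longleftrightarrow> m = 1 \<and> n = 0 \<or> m = 0 \<and> n = 1" for m n :: nat by auto
  have "{elt u m n | u m n. m + n + 1 = 2}
      = ({elt u 1 0 | u. True} \<union> {elt u 0 1 | u. True} :: ('a, 'n) kk set)"
    unfolding index by auto
  then show ?thesis by (simp add: kk_weight_space_def)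
qed

theorem theorem3p1:
  shows "(\<forall>l\<ge>1. conformal_data.simple kk_scale
            (kk_grading l :: bit \<Rightarrow> ('a::field_char_0, 'n::finite) kk set) kk_deriv (kk_Y (kk_copy l)))
    \<and> (\<forall>l\<ge>2.
         (kk_weight_space l l :: ('a, 'n) kk set) = {elt u 0 (l - 2) | u. True} \<and>
         (CARD('n) > 1 \<longrightarrow>
            conformal_data.generated_by kk_scale (kk_grading l) (kk_Y (kk_copy l))
              (kk_weight_space l l :: ('a, 'n) kk set)) \<and>
         (CARD('n) = 1 \<longrightarrow>
            conformal_data.generated_by kk_scale (kk_grading l) (kk_Y (kk_copy l))
              {elt (mat 1) 0 (l - 2) :: ('a, 'n) kk, elt (mat 1) 0 (l - 1)}))
    \<and> ((kk_weight_space 1 2 :: ('a, 'n) kk set)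
           = module.span kk_scale ({elt u 1 0 | u. True} \<union> {elt u 0 1 | u. True}) \<and>
       (CARD('n) > 1 \<longrightarrow>
          conformal_data.generated_by kk_scale (kk_grading 1) (kk_Y (kk_copy 1))
            (kk_weight_space 1 2 :: ('a, 'n) kk set)) \<and>
       (CARD('n) = 1 \<longrightarrow>
          conformal_data.generated_by kk_scale (kk_grading 1) (kk_Y (kk_copy 1))
            {elt (mat 1) 1 0 :: ('a, 'n) kk, elt (mat 1) 0 2}))"
proof (intro conjI allI impI)
  fix l :: nat
  show "conformal_data.simple kk_scale (kk_grading l :: bit \<Rightarrow> ('a, 'n) kk set) kk_deriv (kk_Y (kk_copy l))"
    by (rule kk_simple)
next
  fix l :: nat assume l: "l \<ge> 2"
  show eq: "(kk_weight_space l l :: ('a, 'n) kk set) = {elt u 0 (l - 2) | u. True}"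
    using l by (rule kk_weight_space_lowest)
  have copy: "kk_copy l = 0" using l by (simp add: kk_copy_def)
  \<comment> \<open>The pair \<open>(0, l - 2)\<close> serves as both \<open>(0, e)\<close> and
    \<open>(f, c)\<close>; \<open>f = 0\<close> is allowed because of the extra degree in copy
    0.\<close>
  show "conformal_data.generated_by kk_scale (kk_grading l) (kk_Y (kk_copy l))
      (kk_weight_space l l :: ('a, 'n) kk set)" if "CARD('n) > 1"
    unfolding eq
    by (rule kk_generated_if_card_gt_1[OF that, of _ _ "l - 2" 0])
       (auto simp: copy intro: elt_in_kk_R)
  show "conformal_data.generated_by kk_scale (kk_grading l) (kk_Y (kk_copy l))
      {elt (mat 1) 0 (l - 2) :: ('a, 'n) kk, elt (mat 1) 0 (l - 1)}" (is "conformal_data.generated_by _ _ _ ?S")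
    if "CARD('n) = 1"
  proof (rule kk_generated_if_card_eq_1[OF that])
    show "?S \<subseteq> kk_R l" by (auto intro: elt_in_kk_R)
    show "elt (mat 1) 0 (l - 2) \<in> ?S" "elt (mat 1) 0 (l - 2) \<in> ?S" by simp_all
    fix V :: "('a, 'n) kk set" and r
    assume "kk_closed (kk_copy l) V" "?S \<subseteq> V" "elt (mat 1) 0 r \<in> V"
    moreover have "l - 1 = l - 2 + 1" using l by simp
    ultimately have "elt (mat 1) 0 (l - 2 + r + 1) \<in> V"
      by (intro kk_copy_0_raise) (simp_all add: copy)
    then show "\<exists>r'>r. elt (mat 1) 0 r' \<in> V" by (intro exI[of _ "l - 2 + r + 1"]) simp
  qed
next
  show eq: "(kk_weight_space 1 2 :: ('a, 'n) kk set)
      = module.span kk_scale ({elt u 1 0 | u. True} \<union> {elt u 0 1 | u. True})"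
    by (rule kk_weight_space_1_2)
  have "elt u m n \<in> kk_R 1" for u :: "'a^'n^'n" and m n by (rule elt_in_kk_R) simp
  then have R: "kk_weight_space 1 2 \<subseteq> (kk_R 1 :: ('a, 'n) kk set)"
    unfolding eq by (intro kk.span_minimal[OF _ subspace_kk_R]) auto
  \<comment> \<open>Here \<open>e = f = 1\<close>, and the natural number \<open>1 - 2\<close> is
    0.\<close>
  have "elt u 0 1 \<in> kk_weight_space 1 2" "elt u 1 (1 - 2) \<in> kk_weight_space 1 2" for u :: "'a^'n^'n"
    unfolding eq by (auto intro!: kk.span_base)
  then show "conformal_data.generated_by kk_scale (kk_grading 1) (kk_Y (kk_copy 1))
      (kk_weight_space 1 2 :: ('a, 'n) kk set)" if "CARD('n) > 1"
    by (intro kk_generated_if_card_gt_1[OF that R, of 1 1]) auto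
  show "conformal_data.generated_by kk_scale (kk_grading 1) (kk_Y (kk_copy 1))
      {elt (mat 1) 1 0 :: ('a, 'n) kk, elt (mat 1) 0 2}" (is "conformal_data.generated_by _ _ _ ?S")
    if "CARD('n) = 1"
  proof (rule kk_generated_if_card_eq_1[OF that])
    show "?S \<subseteq> kk_R 1" by (auto intro: elt_in_kk_R)
    show "elt (mat 1) 1 (1 - 2) \<in> ?S" "elt (mat 1) 0 2 \<in> ?S" by simp_all
    fix V :: "('a, 'n) kk set" and r
    assume "kk_closed (kk_copy 1) V" "?S \<subseteq> V" "elt (mat 1) 0 r \<in> V"
    then have "elt (mat 1) 0 (r + 1) \<in> V"
      by (intro kk_copy_1_raise) (simp_all add: kk_copy_def)
    then show "\<exists>r'>r. elt (mat 1) 0 r' \<in> V" by (intro exI[of _ "r + 1"]) simp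
  qed
qed

end
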